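(* Let $X$ be a centered, nondegenerate, infinitely divisible real random variable with finite variance $V>0$ and Lévy measure $\nu$. Suppose the positive part of $\nu$ has bounded support with radius $$b=\sup\{x>0:x\in\operatorname{supp}\nu\}\in(0,\infty).$$ Then $\log M_R(t)/t\to b$ as $t\to\infty$; with $t_\theta=\inf\{t>0:M_R(t)>\theta\}$ one has $\lim_{\theta\to\infty}t_{\lambda\theta}/t_\theta=1$ for every fixed $\lambda>1$; and $$c_*(v)\sim\frac{b}{\log(v/V)}\qquad(v\to\infty).$$
   Context: Standing setting: $X$ is a centered, nondegenerate, infinitely divisible real random variable with variance $0<V=\mathrm{Var}(X)<\infty$, Gaussian variance $a\ge0$ and Lévy measure $\nu$ on $\mathbb{R}\setminus\{0\}$. For all real $t$, $K_X(t)=\log\mathbb{E}e^{tX}=\frac{at^2}{2}+\int_{\mathbb{R}\setminus\{0\}}(e^{tx}-1-tx)\,\nu(dx)\in[0,\infty]$, and $V=a+\int x^2\,\nu(dx)$. Let $H_X(dx)=a\delta_0(dx)+x^2\nu(dx)$ (total mass $V$), let $Z$ have law $H_X/V$, let $B\sim\mathrm{Beta}(1,2)$ (density $2(1-b)$ on $(0,1)$) be independent of $Z$, and put $R=BZ$, $M_R(t)=\mathbb{E}e^{tR}\in(0,\infty]$. A pair $(v,c)\in(0,\infty)\times[0,\infty)$ is feasible for $X$ if $K_X(t)\le \frac{vt^2}{2(1-ct)}$ for every $0\le t<1/c$ (with $1/0=\infty$; for $c=0$: for all $t\ge0$). $c_*(v)=\inf\{c\ge0:(v,c)\text{ is feasible}\}\in[0,\infty]$,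 with $\inf\emptyset=\infty$. *)

theory Defs
  imports "HOL-Probability.Probability" "HOL-Library.Landau_Symbols"
begin

definition infinitely_divisible :: "real measure \<Rightarrow> bool" where
  "infinitely_divisible \<mu> \<longleftrightarrow> real_distribution \<mu> \<and>
     (\<forall>n\<ge>1. \<exists>\<rho>. real_distribution \<rho> \<and> ((\<lambda>L. convolution \<rho> L) ^^ n) (return borel 0) = \<mu>)"

text \<open>Levy measures live on the punctured line; here they are Borel measures on the whole line
  that do not charge the origin.\<close>

definition levy_measure :: "real measure \<Rightarrow> bool" where
  "levy_measure \<nu> \<longleftrightarrow> sets \<nu> = sets borel \<and> emeasure \<nu> {0} = 0 \<and>
     (\<integral>\<^sup>+x. ennreal (min 1 (x\<^sup>2)) \<partial>\<nu>) < \<infinity>"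

text \<open>The law \<open>\<mu>\<close> has Gaussian variance \<open>a\<close> and Levy measure \<open>\<nu>\<close>: the Levy--Khintchine
  representation of the characteristic function, for some drift \<open>\<gamma>\<close>.\<close>

definition has_levy_khintchine :: "real measure \<Rightarrow> real \<Rightarrow> real measure \<Rightarrow> bool" where
  "has_levy_khintchine \<mu> a \<nu> \<longleftrightarrow> 0 \<le> a \<and> levy_measure \<nu> \<and>
     (\<exists>\<gamma>::real. \<forall>t::real. char \<mu> t =
        exp (\<i> * of_real (\<gamma> * t) - of_real (a * t\<^sup>2 / 2) +
          (CLINT x|\<nu>. iexp (t * x) - 1 - \<i> * of_real (t * x * indicator {-1..1} x))))"

definition measure_supp :: "real measure \<Rightarrow> real set" where
  "measure_supp \<nu> = {x. \<forall>U. open U \<and> x \<in> U \<longrightarrow> emeasure \<nu> U > 0}"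

text \<open>\<open>H(dx) = a \<delta>\<^sub>0(dx) + x\<^sup>2 \<nu>(dx)\<close>\<close>

definition H_measure :: "real \<Rightarrow> real measure \<Rightarrow> real measure" where
  "H_measure a \<nu> = measure_of UNIV (sets borel)
     (\<lambda>A. ennreal a * indicator A 0 + (\<integral>\<^sup>+x. ennreal (x\<^sup>2) * indicator A x \<partial>\<nu>))"

lemma space_H_measure [simp]: "space (H_measure a \<nu>) = UNIV"
  and sets_H_measure [simp]: "sets (H_measure a \<nu>) = sets borel"
  by (simp_all add: H_measure_def space_measure_of_conv sets.sigma_sets_eq[of borel, simplified])

lemma emeasure_H_measure:
  assumes \<nu>: "sets \<nu> = sets borel" and A: "A \<in> sets borel"
  shows "emeasure (H_measure a \<nu>) A =
    ennreal a * indicator A 0 + (\<integral>\<^sup>+x. ennreal (x\<^sup>2) * indicator A x \<partial>\<nu>)"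
proof -
  have eq: "ennreal a * indicator B 0 + (\<integral>\<^sup>+x. ennreal (x\<^sup>2) * indicator B x \<partial>\<nu>) =
    (\<integral>\<^sup>+x. ennreal a * indicator B x \<partial>return borel 0) + emeasure (density \<nu> (\<lambda>x. ennreal (x\<^sup>2))) B"
    if B: "B \<in> sets borel" for B
  proof -
    have "(\<lambda>x. ennreal (x\<^sup>2)) \<in> borel_measurable \<nu>"
      using \<nu> by (simp add: measurable_cong_sets[OF \<nu> refl])
    then show ?thesis using B \<nu> by (simp add: emeasure_density nn_integral_return)
  qed
  let ?m = "\<lambda>A. ennreal a * indicator A 0 + (\<integral>\<^sup>+x. ennreal (x\<^sup>2) * indicator A x \<partial>\<nu>)"
  have "countably_additive (sets borel) ?m"
  proof (rule countably_additiveI)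
    fix F :: "nat \<Rightarrow> real set"
    assume F: "range F \<subseteq> sets borel" "disjoint_family F" "\<Union> (range F) \<in> sets borel"
    have Fi: "F i \<in> sets borel" for i using F by auto
    have "(\<Sum>i. ?m (F i)) = (\<Sum>i. \<integral>\<^sup>+x. ennreal a * indicator (F i) x \<partial>return borel 0) +
        (\<Sum>i. emeasure (density \<nu> (\<lambda>x. ennreal (x\<^sup>2))) (F i))"
      by (simp only: eq[OF Fi] suminf_add[symmetric] summableI)
    also have "(\<Sum>i. \<integral>\<^sup>+x. ennreal a * indicator (F i) x \<partial>return borel 0)
        = (\<Sum>i. ennreal a * emeasure (return borel 0) (F i))"
      using Fi by (simp add: nn_integral_cmult_indicator)
    also have "\<dots> = ennreal a * emeasure (return borel 0) (\<Union> (range F))"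
      using F suminf_emeasure[of F "return borel 0"] by (simp del: emeasure_return)
    also have "\<dots> = (\<integral>\<^sup>+x. ennreal a * indicator (\<Union> (range F)) x \<partial>return borel 0)"
      using F by (simp add: nn_integral_cmult_indicator)
    also have "(\<Sum>i. emeasure (density \<nu> (\<lambda>x. ennreal (x\<^sup>2))) (F i)) =
        emeasure (density \<nu> (\<lambda>x. ennreal (x\<^sup>2))) (\<Union> (range F))"
      using F \<nu> by (intro suminf_emeasure) auto
    finally show "(\<Sum>i. ?m (F i)) = ?m (\<Union> (range F))"
      by (simp only: eq[OF F(3)])
  qed
  then show ?thesis
    using A by (intro emeasure_measure_of[OF H_measure_def]) (auto simp: positive_def)
qed

definition mgf :: "'w measure \<Rightarrow> ('w \<Rightarrow> real) \<Rightarrow> real \<Rightarrow> ennreal" where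
  "mgf M Y t = (\<integral>\<^sup>+w. ennreal (exp (t * Y w)) \<partial>M)"

definition ext_ln :: "ennreal \<Rightarrow> ereal" where
  "ext_ln x = (if x = 0 then -\<infinity> else if x = \<infinity> then \<infinity> else ereal (ln (enn2real x)))"

definition cgf :: "'w measure \<Rightarrow> ('w \<Rightarrow> real) \<Rightarrow> real \<Rightarrow> ereal" where
  "cgf M Y t = ext_ln (mgf M Y t)"

text \<open>The disjunct \<open>c = 0\<close> implements the convention \<open>1/0 = \<infinity>\<close>.\<close>

definition feasible :: "'w measure \<Rightarrow> ('w \<Rightarrow> real) \<Rightarrow> real \<Rightarrow> real \<Rightarrow> bool" where
  "feasible M Y v c \<longleftrightarrow> 0 < v \<and> 0 \<le> c \<and>
     (\<forall>t\<ge>0. c = 0 \<or> t < 1 / c \<longrightarrow> cgf M Y t \<le> ereal (v * t\<^sup>2 / (2 * (1 - c * t))))"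

definition c_star :: "'w measure \<Rightarrow> ('w \<Rightarrow> real) \<Rightarrow> real \<Rightarrow> ereal" where
  "c_star M Y v = (INF c\<in>{c. feasible M Y v c}. ereal c)"

definition first_passage :: "(real \<Rightarrow> ennreal) \<Rightarrow> real \<Rightarrow> ereal" where
  "first_passage f \<theta> = (INF t\<in>{t. 0 < t \<and> f t > ennreal \<theta>}. ereal t)"

end

theory Submission
  imports Defs "HOL-Real_Asymp.Real_Asymp"
begin

text \<open>Everything rests on the identity \<open>log E exp (tX) = (V t\<^sup>2 / 2) M\<^sub>R(t)\<close> for \<open>t \<ge> 0\<close> and on
  the two-sided bound \<open>p exp (ct) \<le> M\<^sub>R(t) \<le> exp (bt)\<close>, where \<open>c < b\<close> is arbitrary and \<open>p > 0\<close>
  depends on \<open>c\<close>. The upper bound holds because \<open>R \<le> b\<close> almost surely, the lower one because \<open>R\<close>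
  exceeds each \<open>c < b\<close> with positive probability.

  The bounds alone give \<open>log M\<^sub>R(t) / t \<rightarrow> b\<close> (\<open>ln_div_tendsto\<close>) and first passage times
  asymptotic to \<open>log \<theta> / b\<close>, which does not see a constant factor in \<open>\<theta>\<close>
  (\<open>passage_ratio_tendsto\<close>). By the identity, \<open>(v, c)\<close> is feasible iff \<open>V M\<^sub>R(t) (1 - ct) \<le> v\<close>
  for \<open>0 < t < 1/c\<close>. Since \<open>M\<^sub>R(t) \<le> exp (bt)\<close>, this is true for \<open>c = b / log (v/V)\<close>, as \<open>bt <
  log (v/V)\<close> on the relevant range (\<open>feasible_rate\<close>). If \<open>c\<close> is smaller by a factor \<open>1 - e\<close>, it
  fails at some \<open>t\<close> slightly larger than \<open>log (v/V) / b\<close>, where the factor \<open>1 - ct\<close> stays away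
  from \<open>0\<close> while \<open>M\<^sub>R(t)\<close> beats \<open>v/V\<close> by a power of \<open>v\<close> (\<open>feasible_lower_bound\<close>).

  The work is in the identity, since the Levy--Khintchine formula speaks only about the
  characteristic function \<open>\<phi>\<close> and it is not even clear beforehand that \<open>X\<close> has exponential
  moments. Differentiating the formula turns it into \<open>E[X exp (isX)] = V i s \<phi>(s) E exp (isUZ)\<close>
  with \<open>U\<close> uniform on \<open>[0, 1]\<close> (\<open>char_derivative_equation\<close>, with \<open>Z\<close> expressed through \<open>\<nu>\<close>). If
  \<open>W\<close> has law \<open>x\<^sup>2/V\<close> times that of \<open>X\<close>, the left-hand side is \<open>V i s E exp (isUW)\<close>; so
  uniqueness of characteristic functions gives an equality of laws, \<open>U W\<close> on one side and \<open>X + U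
  Z\<close> with independent summands on the other (\<open>zero_bias_eq\<close>; the first is the zero-bias
  transform of \<open>X\<close>). An equality of laws can be tested on any nonnegative function. Truncated
  exponentials, together with \<open>U Z \<le> b\<close>, bound \<open>E exp (tX)\<close> (\<open>integrable_exp\<close>); the exponentials
  themselves then say that \<open>m(t) = E exp (tX)\<close> satisfies \<open>m' = k' m\<close>, where \<open>k\<close> is the cumulant
  function written in terms of the Levy measure, whence \<open>m = exp k\<close>
  (\<open>exp_moment_eq_exp_cumulant\<close>). Finally, integrating the moment generating function of
  \<open>Beta(1,2)\<close> against the law of \<open>Z\<close> shows \<open>k(t) = (V t\<^sup>2 / 2) M\<^sub>R(t)\<close> (\<open>cumulant_eq_mgf\<close>).\<close>

section \<open>Uniform multiples and convolutions of laws\<close>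

text \<open>The value \<open>\<integral>\<^sub>0\<^sup>1 exp (u z) du\<close>, over the reals and the complex numbers alike: the same kernel serves for
  characteristic functions and for exponential moments.\<close>

definition expm1_quot :: "'a::{real_normed_field,banach} \<Rightarrow> 'a" where
  "expm1_quot z = (if z = 0 then 1 else (exp z - 1) / z)"

abbreviation unif01 :: "real measure" where
  "unif01 \<equiv> uniform_measure lborel {0..1}"

lemma prob_space_unif01: "prob_space unif01"
  by (rule prob_space_uniform_measure) auto

lemma unif01_eq_density: "unif01 = density lborel (\<lambda>u. ennreal (indicat_real {0..1} u))"
  unfolding uniform_measure_def by (simp add: divide_ennreal_def ennreal_indicator)

lemma has_bochner_integral_exp_unif01:
  fixes z :: "'a::{real_normed_field,euclidean_space}"
  shows "has_bochner_integral unif01 (\<lambda>u. exp (of_real u * z)) (expm1_quot z)"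
proof -
  have "has_bochner_integral lborel (\<lambda>u. indicator {0..1} u *\<^sub>R exp (of_real u * z)) (expm1_quot z)"
  proof (cases "z = 0")
    case True
    have "has_bochner_integral lborel (\<lambda>u::real. indicator {0..1} u *\<^sub>R (1::'a)) (of_real 1 - of_real 0)"
      by (rule has_bochner_integral_FTC_Icc) (auto intro!: derivative_eq_intros)
    then show ?thesis using True by (simp add: expm1_quot_def)
  next
    case False
    have D: "((\<lambda>u. exp (of_real u * z) / z) has_vector_derivative exp (of_real u * z)) (at u within A)" for u A
    proof -
      have "((\<lambda>w. exp (w * z) / z) has_field_derivative exp (of_real u * z)) (at (of_real u) within of_real ` A)"
        using False by (auto intro!: derivative_eq_intros)
      from field_vector_diff_chain_within[OF
          bounded_linear.has_vector_derivative[OF bounded_linear_of_real has_vector_derivative_id] this]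
      show ?thesis by (simp add: o_def)
    qed
    have "has_bochner_integral lborel (\<lambda>u. indicator {0..1} u *\<^sub>R exp (of_real u * z))
       (exp (of_real 1 * z) / z - exp (of_real 0 * z) / z)"
      by (rule has_bochner_integral_FTC_Icc) (auto intro!: D continuous_intros)
    then show ?thesis using False by (simp add: expm1_quot_def diff_divide_distrib)
  qed
  then show ?thesis
    by (simp add: unif01_eq_density has_bochner_integral_density)
qed

lemma nn_integral_exp_unif01:
  "(\<integral>\<^sup>+u. ennreal (exp (u * y)) \<partial>unif01) = ennreal (expm1_quot (y::real))"
  using has_bochner_integral_exp_unif01[of y]
  by (subst nn_integral_eq_integral) (auto simp: has_bochner_integral_iff)

lemma expm1_quot_real_nonneg: "0 \<le> expm1_quot (y::real)"
  unfolding expm1_quot_def by (auto simp: divide_simps)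

lemma borel_measurable_expm1_quot [measurable]:
  "expm1_quot \<in> borel_measurable (borel :: 'a::{real_normed_field,banach,second_countable_topology} measure)"
  unfolding expm1_quot_def by measurable

text \<open>The law of \<open>U W\<close> for independent \<open>U\<close> and \<open>W\<close>, with \<open>U\<close> uniform on \<open>[0, 1]\<close>.\<close>

definition uniform_multiple :: "real measure \<Rightarrow> real measure" where
  "uniform_multiple W = distr (W \<Otimes>\<^sub>M unif01) borel (\<lambda>(w, u). u * w)"

lemma real_distribution_uniform_multiple:
  assumes "real_distribution W"
  shows "real_distribution (uniform_multiple W)"
proof -
  interpret W: real_distribution W by fact
  interpret U: prob_space unif01 by (rule prob_space_unif01)
  interpret P: pair_prob_space W unif01 ..
  show ?thesis unfolding uniform_multiple_def
    by (rule P.real_distribution_distr) auto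
qed

lemma nn_integral_uniform_multiple:
  assumes "real_distribution W" and [measurable]: "f \<in> borel_measurable borel"
  shows "(\<integral>\<^sup>+y. f y \<partial>uniform_multiple W) = (\<integral>\<^sup>+w. \<integral>\<^sup>+u. f (u * w) \<partial>unif01 \<partial>W)"
proof -
  interpret W: real_distribution W by fact
  interpret U: prob_space unif01 by (rule prob_space_unif01)
  show ?thesis unfolding uniform_multiple_def
    by (simp add: nn_integral_distr U.nn_integral_fst[symmetric] split_beta')
qed

lemma char_uniform_multiple:
  assumes "real_distribution W"
  shows "char (uniform_multiple W) s = (CLINT w|W. expm1_quot (\<i> * of_real (s * w)))"
    and "integrable W (\<lambda>w. expm1_quot (\<i> * of_real (s * w)))"
proof -
  interpret W: real_distribution W by fact
  interpret U: prob_space unif01 by (rule prob_space_unif01)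
  interpret P: pair_prob_space W unif01 ..
  have int: "integrable (W \<Otimes>\<^sub>M unif01) (\<lambda>p. iexp (s * (snd p * fst p)))"
    by (rule P.integrable_const_bound[where B=1]) auto
  have inner: "(CLINT u|unif01. iexp (s * (u * w))) = expm1_quot (\<i> * of_real (s * w))" for w
    using has_bochner_integral_exp_unif01[of "\<i> * of_real (s * w)"]
    by (simp add: has_bochner_integral_iff mult_ac)
  have "char (uniform_multiple W) s = (\<integral>p. iexp (s * (snd p * fst p)) \<partial>(W \<Otimes>\<^sub>M unif01))"
    unfolding char_def uniform_multiple_def by (simp add: integral_distr split_beta')
  also have "\<dots> = (CLINT w|W. CLINT u|unif01. iexp (s * (u * w)))"
    using P.integral_fst'[OF int] by simp
  finally show "char (uniform_multiple W) s = (CLINT w|W. expm1_quot (\<i> * of_real (s * w)))"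
    by (simp only: inner)
  show "integrable W (\<lambda>w. expm1_quot (\<i> * of_real (s * w)))"
    using P.integrable_fst'[OF int] by (simp only: inner fst_conv snd_conv)
qed

lemma real_distribution_convolution:
  assumes "real_distribution M1" "real_distribution M2"
  shows "real_distribution (M1 \<star> M2)"
proof -
  interpret M1: real_distribution M1 by fact
  interpret M2: real_distribution M2 by fact
  interpret P: pair_prob_space M1 M2 ..
  show ?thesis unfolding convolution_def
    by (rule P.real_distribution_distr) auto
qed

lemma char_convolution:
  assumes "real_distribution M1" "real_distribution M2"
  shows "char (M1 \<star> M2) s = char M1 s * char M2 s"
proof -
  interpret M1: real_distribution M1 by fact
  interpret M2: real_distribution M2 by fact
  interpret P: pair_prob_space M1 M2 ..
  have int: "integrable (M1 \<Otimes>\<^sub>M M2) (\<lambda>p. iexp (s * (fst p + snd p)))"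
    by (rule P.integrable_const_bound[where B=1]) auto
  have "char (M1 \<star> M2) s = (\<integral>p. iexp (s * (fst p + snd p)) \<partial>(M1 \<Otimes>\<^sub>M M2))"
    unfolding char_def convolution_def by (simp add: integral_distr split_beta')
  also have "\<dots> = (CLINT x|M1. CLINT y|M2. iexp (s * (x + y)))"
    using P.integral_fst'[OF int] by simp
  also have "\<dots> = char M1 s * char M2 s"
    unfolding char_def by (simp add: distrib_left exp_add)
  finally show ?thesis .
qed

section \<open>Differentiating compensated exponential integrals\<close>

text \<open>The second-order Taylor remainder of \<open>w \<mapsto> exp (x w)\<close> on the convex set \<open>S\<close> is at most
  \<open>x\<^sup>2 g(x) |w - z|\<^sup>2\<close>. It can be integrated as it stands, so the difference quotients need no passage to
  the limit under the integral. The set \<open>S\<close> is the imaginary axis (with \<open>g = 1\<close>) for characteristic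
  exponents and an interval \<open>[0, T]\<close> for exponential moments. Subtracting \<open>1 + x z\<close> makes the integrand
  of order \<open>x\<^sup>2\<close> at \<open>0\<close>, where a Levy measure may have infinite mass.\<close>

lemma exp_moment_has_derivative:
  fixes S :: "'a::{real_normed_field,euclidean_space} set"
  assumes S: "convex S" "0 \<in> S" and l: "sets L = sets borel"
    and bd: "AE x in L. \<forall>z\<in>S. norm (exp (of_real x * z)) \<le> g x"
    and g: "integrable L (\<lambda>x. x\<^sup>2 * g x)"
    and z: "z \<in> S"
  defines "f \<equiv> \<lambda>z x. exp (of_real x * z) - 1 - of_real x * z"
    and "f' \<equiv> \<lambda>z x. of_real x * (exp (of_real x * z) - 1)"
  shows "integrable L (f z)" and "integrable L (f' z)"
    and "((\<lambda>z. integral\<^sup>L L (f z)) has_field_derivative integral\<^sup>L L (f' z)) (at z within S)"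
proof -
  have lm [measurable_cong]: "sets L = sets borel" by fact
  have T1: "norm (exp (of_real x * w) - exp (of_real x * z) - of_real x * exp (of_real x * z) * (w - z))
      \<le> x\<^sup>2 * g x * (norm (w - z))\<^sup>2"
    if x: "\<forall>z\<in>S. norm (exp (of_real x * z)) \<le> g x" and "z \<in> S" "w \<in> S" for x w z
  proof -
    have "norm ((\<lambda>w. of_real x^0 * exp (of_real x * w)) w - (\<Sum>i\<le>1. (of_real x^i * exp (of_real x * z)) * (w - z)^i / fact i))
        \<le> (x\<^sup>2 * g x) * norm (w - z)^Suc 1 / fact 1"
      by (rule field_Taylor[of S 1 "\<lambda>i w. of_real x^i * exp (of_real x * w)"])
         (use that S in \<open>auto intro!: derivative_eq_intros mult_left_mono simp: norm_mult norm_power numeral_2_eq_2\<close>)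
    then show ?thesis by (simp add: algebra_simps power2_eq_square)
  qed
  have T0: "norm (exp (of_real x * z) - 1) \<le> \<bar>x\<bar> * g x * norm z"
    if x: "\<forall>z\<in>S. norm (exp (of_real x * z)) \<le> g x" and "z \<in> S" for x z
  proof -
    have "norm ((\<lambda>w. of_real x^0 * exp (of_real x * w)) z - (\<Sum>i\<le>0. (of_real x^i * exp (of_real x * 0)) * (z - 0)^i / fact i))
        \<le> (\<bar>x\<bar> * g x) * norm (z - 0)^Suc 0 / fact 0"
      by (rule field_Taylor[of S 0 "\<lambda>i w. of_real x^i * exp (of_real x * w)"])
         (use that S in \<open>auto intro!: derivative_eq_intros mult_left_mono simp: norm_mult norm_power numeral_2_eq_2\<close>)
    then show ?thesis by simp
  qed
  have f [measurable]: "f z \<in> borel_measurable L" "f' z \<in> borel_measurable L" for z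
    unfolding f_def f'_def by measurable
  have fi: "integrable L (f z)" if z: "z \<in> S" for z
  proof (rule Bochner_Integration.integrable_bound[OF integrable_mult_left[OF g, of "(norm z)\<^sup>2"]])
    show "AE x in L. norm (f z x) \<le> norm (x\<^sup>2 * g x * (norm z)\<^sup>2)"
      using bd
    proof eventually_elim
      case (elim x)
      then show ?case using T1[OF elim S(2) z] unfolding f_def by (simp add: algebra_simps)
    qed
  qed measurable
  have f'i: "integrable L (f' z)" if z: "z \<in> S" for z
  proof (rule Bochner_Integration.integrable_bound[OF integrable_mult_left[OF g, of "(norm z)"]])
    show "AE x in L. norm (f' z x) \<le> norm (x\<^sup>2 * g x * norm z)"
      using bd
    proof eventually_elim
      case (elim x)
      have "\<bar>x\<bar> * norm (exp (of_real x * z) - 1) \<le> \<bar>x\<bar> * (\<bar>x\<bar> * g x * norm z)"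
        by (intro mult_left_mono T0[OF elim z]) auto
      also have "\<dots> = x\<^sup>2 * g x * norm z" by (simp add: power2_eq_square)
      finally show ?case unfolding f'_def by (simp add: norm_mult)
    qed
  qed measurable
  show "integrable L (f z)" "integrable L (f' z)" using fi f'i z by auto
  define C where "C = (\<integral>x. x\<^sup>2 * g x \<partial>L)"
  have bound: "norm (integral\<^sup>L L (f w) - integral\<^sup>L L (f z) - integral\<^sup>L L (f' z) * (w - z)) \<le> C * (norm (w - z))\<^sup>2"
    if w: "w \<in> S" for w
  proof -
    have "norm (integral\<^sup>L L (f w) - integral\<^sup>L L (f z) - integral\<^sup>L L (f' z) * (w - z))
       = norm (\<integral>x. f w x - f z x - f' z x * (w - z) \<partial>L)"
      using fi[OF w] fi[OF z] f'i[OF z] by simp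
    also have "\<dots> \<le> (\<integral>x. norm (f w x - f z x - f' z x * (w - z)) \<partial>L)"
      by (rule integral_norm_bound)
    also have "\<dots> \<le> (\<integral>x. x\<^sup>2 * g x * (norm (w - z))\<^sup>2 \<partial>L)"
    proof (rule integral_mono_AE)
      show "integrable L (\<lambda>x. norm (f w x - f z x - f' z x * (w - z)))"
        using fi[OF w] fi[OF z] f'i[OF z] by simp
      show "integrable L (\<lambda>x. x\<^sup>2 * g x * (norm (w - z))\<^sup>2)" using g by simp
      show "AE x in L. norm (f w x - f z x - f' z x * (w - z)) \<le> x\<^sup>2 * g x * (norm (w - z))\<^sup>2"
        using bd
      proof eventually_elim
        case (elim x)
        from T1[OF elim z w] show ?case unfolding f_def f'_def by (simp add: algebra_simps)
      qed
    qed
    also have "\<dots> = C * (norm (w - z))\<^sup>2" unfolding C_def by simp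
    finally show ?thesis .
  qed
  show "((\<lambda>z. integral\<^sup>L L (f z)) has_field_derivative integral\<^sup>L L (f' z)) (at z within S)"
    unfolding has_field_derivative_def has_derivative_within_alt
  proof (intro conjI allI impI)
    show "bounded_linear ((*) (integral\<^sup>L L (f' z)))" by (rule bounded_linear_mult_right)
    fix e :: real assume e: "0 < e"
    show "\<exists>d>0. \<forall>y\<in>S. norm (y - z) < d \<longrightarrow>
        norm (integral\<^sup>L L (f y) - integral\<^sup>L L (f z) - integral\<^sup>L L (f' z) * (y - z)) \<le> e * norm (y - z)"
    proof (intro exI[of _ "e / (\<bar>C\<bar> + 1)"] conjI ballI impI)
      show "0 < e / (\<bar>C\<bar> + 1)" using e by (simp add: add_nonneg_pos)
      fix y assume y: "y \<in> S" "norm (y - z) < e / (\<bar>C\<bar> + 1)"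
      have "C * (norm (y - z))\<^sup>2 \<le> (\<bar>C\<bar> + 1) * norm (y - z) * norm (y - z)"
        unfolding power2_eq_square mult.assoc by (intro mult_right_mono) auto
      also have "\<dots> \<le> e * norm (y - z)"
        using y(2) by (intro mult_right_mono) (auto simp: field_simps)
      finally show "norm (integral\<^sup>L L (f y) - integral\<^sup>L L (f z) - integral\<^sup>L L (f' z) * (y - z)) \<le> e * norm (y - z)"
        using bound[OF y(1)] by linarith
    qed
  qed
qed

lemma exp_moment_imaginary_axis:
  assumes "sets L = sets borel" and "integrable L (\<lambda>x. x\<^sup>2)"
  shows "integrable L (\<lambda>x. exp (of_real x * (\<i> * of_real s)) - 1 - of_real x * (\<i> * of_real s))" (is ?th1)
    and "integrable L (\<lambda>x. of_real x * (exp (of_real x * (\<i> * of_real s)) - 1))" (is ?th2)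
    and "((\<lambda>s. \<integral>x. exp (of_real x * (\<i> * of_real s)) - 1 - of_real x * (\<i> * of_real s) \<partial>L)
      has_vector_derivative \<i> * (\<integral>x. of_real x * (exp (of_real x * (\<i> * of_real s)) - 1) \<partial>L)) (at s)" (is ?th3)
proof -
  let ?S = "range (\<lambda>s::real. \<i> * of_real s)"
  have "linear (\<lambda>s::real. \<i> * of_real s)"
    by (intro linearI) (simp_all add: algebra_simps scaleR_conv_of_real)
  then have S: "convex ?S" by (rule convex_linear_image) simp
  have 0: "0 \<in> ?S" by (auto intro!: image_eqI[of _ _ 0])
  have bd: "AE x in L. \<forall>z\<in>?S. norm (exp (of_real x * z)) \<le> 1" by auto
  have g: "integrable L (\<lambda>x. x\<^sup>2 * 1)" using assms(2) by simp
  have s: "\<i> * of_real s \<in> ?S" by auto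
  note * = exp_moment_has_derivative[OF S 0 assms(1) bd g s]
  show ?th1 ?th2 using *(1,2) by auto
  have "((\<lambda>s. \<i> * of_real s) has_vector_derivative \<i> * 1) (at s)"
    by (intro has_vector_derivative_mult_right
        bounded_linear.has_vector_derivative[OF bounded_linear_of_real has_vector_derivative_id, simplified])
  from field_vector_diff_chain_within[OF this *(3)] show ?th3 by (simp add: o_def)
qed

section \<open>Integration against the measure \<open>H\<close>\<close>

lemma nn_integral_H_measure:
  assumes \<nu>: "sets \<nu> = sets borel" and f: "f \<in> borel_measurable borel"
  shows "(\<integral>\<^sup>+x. f x \<partial>H_measure a \<nu>) = ennreal a * f 0 + (\<integral>\<^sup>+x. ennreal (x\<^sup>2) * f x \<partial>\<nu>)"
proof -
  have [measurable_cong]: "sets \<nu> = sets borel" by fact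
  have [simp]: "borel_measurable (H_measure a \<nu>) = borel_measurable borel"
    by (rule measurable_cong_sets) auto
  have [simp]: "borel_measurable \<nu> = borel_measurable borel"
    by (rule measurable_cong_sets) (auto simp: \<nu>)
  show ?thesis using f
  proof (induction rule: borel_measurable_induct)
    case (cong f g)
    then show ?case by (simp cong: nn_integral_cong)
  next
    case (set A)
    then show ?case using \<nu> by (simp add: emeasure_H_measure)
  next
    case (mult u c)
    then have [measurable]: "u \<in> borel_measurable borel" by simp
    show ?case using mult
      by (simp add: nn_integral_cmult distrib_left mult.left_commute[of _ c])
  next
    case (add u v)
    then have [measurable]: "u \<in> borel_measurable borel" "v \<in> borel_measurable borel" by simp_all
    have "(\<integral>\<^sup>+x. ennreal (x\<^sup>2) * (u x + v x) \<partial>\<nu>)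
        = (\<integral>\<^sup>+x. ennreal (x\<^sup>2) * u x \<partial>\<nu>) + (\<integral>\<^sup>+x. ennreal (x\<^sup>2) * v x \<partial>\<nu>)"
      unfolding distrib_left by (rule nn_integral_add) auto
    then show ?case using add by (simp add: nn_integral_add distrib_left add_ac)
  next
    case (seq U)
    then have [measurable]: "U i \<in> borel_measurable borel" for i by simp
    have inc: "incseq (\<lambda>i x. ennreal (x\<^sup>2) * U i x)"
      using seq by (auto simp: incseq_def le_fun_def intro!: mult_left_mono)
    have "(\<integral>\<^sup>+x. (SUP i. U i) x \<partial>H_measure a \<nu>) = (SUP i. \<integral>\<^sup>+x. U i x \<partial>H_measure a \<nu>)"
      using seq unfolding SUP_apply by (intro nn_integral_monotone_convergence_SUP) auto
    also have "\<dots> = (SUP i. ennreal a * U i 0 + (\<integral>\<^sup>+x. ennreal (x\<^sup>2) * U i x \<partial>\<nu>))"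
      using seq by simp
    also have "\<dots> = (SUP i. ennreal a * U i 0) + (SUP i. \<integral>\<^sup>+x. ennreal (x\<^sup>2) * U i x \<partial>\<nu>)"
      using seq inc by (intro ennreal_SUP_add)
        (auto simp: incseq_def le_fun_def intro!: mult_left_mono nn_integral_mono)
    also have "(SUP i. \<integral>\<^sup>+x. ennreal (x\<^sup>2) * U i x \<partial>\<nu>) = (\<integral>\<^sup>+x. (SUP i. ennreal (x\<^sup>2) * U i x) \<partial>\<nu>)"
      using inc by (intro nn_integral_monotone_convergence_SUP[symmetric]) auto
    finally show ?case by (simp add: SUP_mult_left_ennreal image_comp)
  qed
qed

lemma integral_H_measure:
  fixes f :: "real \<Rightarrow> 'b::{banach, second_countable_topology}"
  assumes \<nu>: "sets \<nu> = sets borel" and a: "0 \<le> a" and f: "integrable (H_measure a \<nu>) f"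
  shows "integrable \<nu> (\<lambda>x. x\<^sup>2 *\<^sub>R f x) \<and>
    (\<integral>x. f x \<partial>H_measure a \<nu>) = a *\<^sub>R f 0 + (\<integral>x. x\<^sup>2 *\<^sub>R f x \<partial>\<nu>)"
proof -
  have [measurable_cong]: "sets \<nu> = sets borel" by fact
  have [simp]: "borel_measurable (H_measure a \<nu>) = borel_measurable borel"
    by (rule measurable_cong_sets) auto
  have int: "integrable \<nu> (\<lambda>x. x\<^sup>2 *\<^sub>R f x)" if "integrable (H_measure a \<nu>) f"
    for f :: "real \<Rightarrow> 'b"
  proof (rule integrableI_bounded)
    have [measurable]: "f \<in> borel_measurable borel"
      using borel_measurable_integrable[OF that] by simp
    show "(\<lambda>x. x\<^sup>2 *\<^sub>R f x) \<in> borel_measurable \<nu>" by measurable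
    have "(\<integral>\<^sup>+x. ennreal (norm (x\<^sup>2 *\<^sub>R f x)) \<partial>\<nu>) = (\<integral>\<^sup>+x. ennreal (x\<^sup>2) * ennreal (norm (f x)) \<partial>\<nu>)"
      by (simp add: ennreal_mult)
    also have "\<dots> \<le> (\<integral>\<^sup>+x. ennreal (norm (f x)) \<partial>H_measure a \<nu>)"
      by (subst nn_integral_H_measure[OF \<nu>]) auto
    also have "\<dots> < \<infinity>" using that by (simp add: integrable_iff_bounded)
    finally show "(\<integral>\<^sup>+x. ennreal (norm (x\<^sup>2 *\<^sub>R f x)) \<partial>\<nu>) < \<infinity>" .
  qed
  have "(\<integral>x. f x \<partial>H_measure a \<nu>) = a *\<^sub>R f 0 + (\<integral>x. x\<^sup>2 *\<^sub>R f x \<partial>\<nu>)"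
    using f
  proof (induction rule: integrable_induct)
    case (base A c)
    then have A [measurable]: "A \<in> sets borel" by simp
    have fin: "integrable (H_measure a \<nu>) (indicat_real A)" using base by simp
    have ii: "integrable \<nu> (\<lambda>x. x\<^sup>2 * indicat_real A x)"
    proof (rule integrableI_bounded)
      have "(\<integral>\<^sup>+x. ennreal (norm (x\<^sup>2 * indicat_real A x)) \<partial>\<nu>) = (\<integral>\<^sup>+x. ennreal (x\<^sup>2) * indicator A x \<partial>\<nu>)"
        by (auto intro!: nn_integral_cong split: split_indicator)
      also have "\<dots> \<le> emeasure (H_measure a \<nu>) A"
        by (simp add: emeasure_H_measure[OF \<nu>])
      finally show "(\<integral>\<^sup>+x. ennreal (norm (x\<^sup>2 * indicat_real A x)) \<partial>\<nu>) < \<infinity>"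
        using base(2) by (auto simp: top_unique less_top)
    qed measurable
    have "ennreal (measure (H_measure a \<nu>) A) = emeasure (H_measure a \<nu>) A"
      using base(2) by (simp add: emeasure_eq_ennreal_measure)
    also have "\<dots> = ennreal a * indicator A 0 + (\<integral>\<^sup>+x. ennreal (x\<^sup>2 * indicat_real A x) \<partial>\<nu>)"
      unfolding emeasure_H_measure[OF \<nu> A]
      by (intro arg_cong2[where f="(+)"] refl nn_integral_cong) (auto split: split_indicator)
    also have "\<dots> = ennreal (a * indicator A 0 + (\<integral>x. x\<^sup>2 * indicat_real A x \<partial>\<nu>))"
      using a ii by (subst nn_integral_eq_integral)
        (auto simp: ennreal_mult ennreal_plus ennreal_indicator simp del: ennreal_plus[symmetric] split: split_indicator)
    finally have "measure (H_measure a \<nu>) A = a * indicator A 0 + (\<integral>x. x\<^sup>2 * indicat_real A x \<partial>\<nu>)"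
      using a by (subst (asm) ennreal_inj) auto
    moreover have "(\<integral>x. x\<^sup>2 *\<^sub>R indicat_real A x *\<^sub>R c \<partial>\<nu>) = (\<integral>x. x\<^sup>2 * indicat_real A x \<partial>\<nu>) *\<^sub>R c"
      using ii by (subst integral_scaleR_left[symmetric]) auto
    ultimately show ?case using base by (simp add: scaleR_left_distrib)
  next
    case (add f g)
    then show ?case using int[of f] int[of g] by (simp add: scaleR_right_distrib)
  next
    case (lim f s)
    have [measurable]: "f \<in> borel_measurable borel" "s i \<in> borel_measurable borel" for i
      using borel_measurable_integrable[OF lim(1)[of i]] borel_measurable_integrable[OF lim(4)] by simp_all
    have 1: "(\<lambda>i. \<integral>x. s i x \<partial>H_measure a \<nu>) \<longlonglongrightarrow> (\<integral>x. f x \<partial>H_measure a \<nu>)"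
      using lim by (intro integral_dominated_convergence[where w = "\<lambda>x. 2 * norm (f x)"]) auto
    have "integrable \<nu> (\<lambda>x. 2 * norm (x\<^sup>2 *\<^sub>R f x))" using int[OF lim(4)] by (intro integrable_mult_right integrable_norm)
    then have 2: "(\<lambda>i. \<integral>x. x\<^sup>2 *\<^sub>R s i x \<partial>\<nu>) \<longlonglongrightarrow> (\<integral>x. x\<^sup>2 *\<^sub>R f x \<partial>\<nu>)"
      using lim(2,3) by (intro integral_dominated_convergence[where w = "\<lambda>x. 2 * norm (x\<^sup>2 *\<^sub>R f x)"])
        (auto intro!: tendsto_intros AE_I2 simp: mult.left_commute[of 2] mult_left_mono)
    have 3: "(\<lambda>i. a *\<^sub>R s i 0) \<longlonglongrightarrow> a *\<^sub>R f 0"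
      using lim(2) by (intro tendsto_intros) auto
    have "(\<lambda>i. \<integral>x. s i x \<partial>H_measure a \<nu>) \<longlonglongrightarrow> a *\<^sub>R f 0 + (\<integral>x. x\<^sup>2 *\<^sub>R f x \<partial>\<nu>)"
      using tendsto_add[OF 3 2] lim(5) by simp
    from LIMSEQ_unique[OF 1 this] show ?case .
  qed
  with int[OF f] show ?thesis by simp
qed

section \<open>The zero-bias identity\<close>

text \<open>Here \<open>\<mu>\<close> is the law of \<open>X\<close> and \<open>\<zeta>\<close> that of \<open>Z\<close>.\<close>

locale centered_levy_law =
  fixes \<mu> \<nu> \<zeta> :: "real measure" and a V :: real
  assumes real_distribution_mu: "real_distribution \<mu>"
    and levy_khintchine: "has_levy_khintchine \<mu> a \<nu>"
    and square_integrable: "integrable \<mu> (\<lambda>x. x\<^sup>2)"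
    and mean_0: "(\<integral>x. x \<partial>\<mu>) = 0"
    and variance: "(\<integral>x. x\<^sup>2 \<partial>\<mu>) = V"
    and V_pos: "0 < V"
    and real_distribution_zeta: "real_distribution \<zeta>"
    and zeta: "\<zeta> = scale_measure (ennreal (1 / V)) (H_measure a \<nu>)"
begin

sublocale \<mu>: real_distribution \<mu> by (rule real_distribution_mu)
sublocale \<zeta>: real_distribution \<zeta> by (rule real_distribution_zeta)

lemma sets_nu [simp, measurable_cong]: "sets \<nu> = sets borel"
  using levy_khintchine by (simp add: has_levy_khintchine_def levy_measure_def)

lemma a_nonneg: "0 \<le> a"
  using levy_khintchine by (simp add: has_levy_khintchine_def)

lemma nn_integral_zeta:
  assumes [measurable]: "f \<in> borel_measurable borel"
  shows "ennreal V * (\<integral>\<^sup>+z. f z \<partial>\<zeta>) = ennreal a * f 0 + (\<integral>\<^sup>+x. ennreal (x\<^sup>2) * f x \<partial>\<nu>)"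
proof -
  have "ennreal V * (\<integral>\<^sup>+z. f z \<partial>\<zeta>) = ennreal V * (ennreal (1 / V) * (\<integral>\<^sup>+x. f x \<partial>H_measure a \<nu>))"
    unfolding zeta by (subst nn_integral_scale_measure) (auto cong: measurable_cong_sets)
  also have "\<dots> = (\<integral>\<^sup>+x. f x \<partial>H_measure a \<nu>)"
    using V_pos by (simp add: mult.assoc[symmetric] ennreal_mult[symmetric])
  finally show ?thesis by (simp add: nn_integral_H_measure)
qed

lemma integral_zeta:
  fixes f :: "real \<Rightarrow> 'b::{banach, second_countable_topology}"
  assumes f: "integrable \<zeta> f"
  shows "integrable \<nu> (\<lambda>x. x\<^sup>2 *\<^sub>R f x)"
    and "V *\<^sub>R (\<integral>z. f z \<partial>\<zeta>) = a *\<^sub>R f 0 + (\<integral>x. x\<^sup>2 *\<^sub>R f x \<partial>\<nu>)"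
proof -
  have "\<zeta> = density (H_measure a \<nu>) (\<lambda>_. ennreal (1 / V))"
    unfolding zeta by (rule measure_eqI) (auto simp: emeasure_density_const)
  moreover have [measurable]: "f \<in> borel_measurable (H_measure a \<nu>)"
    using borel_measurable_integrable[OF f] by (auto cong: measurable_cong_sets)
  ultimately have 1: "integrable (H_measure a \<nu>) (\<lambda>x. (1 / V) *\<^sub>R f x)"
    and 2: "(\<integral>z. f z \<partial>\<zeta>) = (\<integral>x. (1 / V) *\<^sub>R f x \<partial>H_measure a \<nu>)"
    using V_pos f by (simp_all add: integrable_density integral_density)
  from integrable_scaleR_right[OF 1, of V] have 3: "integrable (H_measure a \<nu>) f"
    using V_pos by simp
  show "integrable \<nu> (\<lambda>x. x\<^sup>2 *\<^sub>R f x)"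
    using integral_H_measure[OF sets_nu a_nonneg 3] by simp
  show "V *\<^sub>R (\<integral>z. f z \<partial>\<zeta>) = a *\<^sub>R f 0 + (\<integral>x. x\<^sup>2 *\<^sub>R f x \<partial>\<nu>)"
    using integral_H_measure[OF sets_nu a_nonneg 3] V_pos 2 by simp
qed

lemma square_integrable_nu: "integrable \<nu> (\<lambda>x. x\<^sup>2)"
  using integral_zeta(1)[of "\<lambda>_. 1::real"] by simp

lemma integrable_id: "integrable \<mu> (\<lambda>x. x)"
  by (rule \<mu>.square_integrable_imp_integrable[OF _ square_integrable]) auto

text \<open>Since \<open>\<nu>\<close> has a finite second moment, \<open>x\<close> is integrable over \<open>|x| > 1\<close>; hence the truncated
  compensator may be replaced by the full one at the price of another drift.\<close>

lemma char_eq_exp_cumulant: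
  "\<exists>\<gamma>. \<forall>s. char \<mu> s = exp (\<i> * of_real (\<gamma> * s) - of_real (a * s\<^sup>2 / 2) +
     (\<integral>x. exp (of_real x * (\<i> * of_real s)) - 1 - of_real x * (\<i> * of_real s) \<partial>\<nu>))"
proof -
  obtain \<gamma> where \<gamma>: "\<And>t. char \<mu> t =
        exp (\<i> * of_real (\<gamma> * t) - of_real (a * t\<^sup>2 / 2) +
          (CLINT x|\<nu>. iexp (t * x) - 1 - \<i> * of_real (t * x * indicator {-1..1} x)))"
    using levy_khintchine unfolding has_levy_khintchine_def by blast
  have int1: "integrable \<nu> (\<lambda>x. x * indicator (- {-1..1}) x)"
  proof (rule Bochner_Integration.integrable_bound[OF square_integrable_nu])
    have "\<bar>x\<bar> \<le> x\<^sup>2" if "\<not> (-1 \<le> x \<and> x \<le> 1)" for x :: real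
      using that self_le_power[of "\<bar>x\<bar>" 2] by auto
    then show "AE x in \<nu>. norm (x * indicat_real (- {-1..1}) x) \<le> norm (x\<^sup>2)"
      by (auto simp: indicator_def)
  qed simp
  define d where "d = (\<integral>x. x * indicator (- {-1..1}) x \<partial>\<nu>)"
  show ?thesis
  proof (intro exI[of _ "\<gamma> + d"] allI)
    fix s
    have int2: "integrable \<nu> (\<lambda>x. exp (of_real x * (\<i> * of_real s)) - 1 - of_real x * (\<i> * of_real s))"
      by (rule exp_moment_imaginary_axis(1)) (auto simp: square_integrable_nu)
    have "(CLINT x|\<nu>. iexp (s * x) - 1 - \<i> * of_real (s * x * indicator {-1..1} x)) =
      (CLINT x|\<nu>. (exp (of_real x * (\<i> * of_real s)) - 1 - of_real x * (\<i> * of_real s))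
          + \<i> * of_real s * complex_of_real (x * indicator (- {-1..1}) x))"
      by (intro Bochner_Integration.integral_cong) (auto simp: indicator_def algebra_simps)
    also have "\<dots> = (CLINT x|\<nu>. (exp (of_real x * (\<i> * of_real s)) - 1 - of_real x * (\<i> * of_real s)))
        + \<i> * of_real s * of_real d"
      unfolding d_def using int2 integrable_of_real[OF int1, where 'a=complex]
      by (subst Bochner_Integration.integral_add) (auto simp del: of_real_mult simp: integral_complex_of_real)
    finally show "char \<mu> s = exp (\<i> * of_real ((\<gamma> + d) * s) - of_real (a * s\<^sup>2 / 2) +
       (\<integral>x. exp (of_real x * (\<i> * of_real s)) - 1 - of_real x * (\<i> * of_real s) \<partial>\<nu>))"
      unfolding \<gamma> by (simp add: algebra_simps)
  qed
qed

text \<open>This is \<open>\<phi>' = \<psi>' \<phi>\<close> for \<open>\<phi> = exp \<psi>\<close>, divided by \<open>\<i>\<close>. Both \<open>\<phi>\<close> and \<open>\<psi>\<close> are compensated exponential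
  integrals, over \<open>\<mu>\<close> and over \<open>\<nu>\<close>. The drift disappears because \<open>\<phi>'(0) = 0\<close>.\<close>

lemma char_derivative_equation:
  "(\<integral>x. of_real x * (exp (of_real x * (\<i> * of_real s)) - 1) \<partial>\<mu>) =
   (\<i> * of_real (a * s) + (\<integral>x. of_real x * (exp (of_real x * (\<i> * of_real s)) - 1) \<partial>\<nu>)) * char \<mu> s"
proof -
  define F where "F = (\<lambda>L s. \<integral>x. exp (of_real x * (\<i> * of_real s)) - 1 - of_real x * (\<i> * of_real s) \<partial>(L :: real measure))"
  define F' where "F' = (\<lambda>L s. \<integral>x. of_real x * (exp (of_real x * (\<i> * of_real s)) - 1) \<partial>(L :: real measure))"
  have DF: "(F L has_vector_derivative \<i> * F' L s) (at s)" if "L = \<mu> \<or> L = \<nu>" for s L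
    using exp_moment_imaginary_axis(3)[of L s] that square_integrable square_integrable_nu
    unfolding F_def F'_def by auto
  obtain \<gamma> where \<gamma>: "\<And>s. char \<mu> s = exp (\<i> * of_real (\<gamma> * s) - of_real (a * s\<^sup>2 / 2) + F \<nu> s)"
    using char_eq_exp_cumulant unfolding F_def by blast
  have char_F: "char \<mu> s = 1 + F \<mu> s" for s
  proof -
    have "char \<mu> s = (CLINT x|\<mu>. (exp (of_real x * (\<i> * of_real s)) - 1 - of_real x * (\<i> * of_real s))
        + (1 + \<i> * of_real s * of_real x))"
      unfolding char_def by (intro Bochner_Integration.integral_cong) (auto simp: algebra_simps)
    also have "\<dots> = F \<mu> s + (CLINT x|\<mu>. 1 + \<i> * of_real s * of_real x)"
      unfolding F_def using exp_moment_imaginary_axis(1)[of \<mu> s] square_integrable integrable_id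
      by (subst Bochner_Integration.integral_add) auto
    also have "(CLINT x|\<mu>. 1 + \<i> * of_real s * of_real x) = 1"
      using integrable_id mean_0 \<mu>.prob_space
      by (subst Bochner_Integration.integral_add) (auto simp: integral_complex_of_real)
    finally show ?thesis by simp
  qed
  have eq: "\<i> * F' \<mu> s = (\<i> * of_real \<gamma> - of_real (a * s) + \<i> * F' \<nu> s) * char \<mu> s" for s
  proof (rule vector_derivative_unique_at)
    show "(char \<mu> has_vector_derivative \<i> * F' \<mu> s) (at s)"
      using has_vector_derivative_add[OF has_vector_derivative_const DF[of \<mu> s], of 1]
      by (simp add: char_F[abs_def])
    have D1: "((\<lambda>s. \<i> * of_real (\<gamma> * s) - of_real (a * s\<^sup>2 / 2) + F \<nu> s) has_vector_derivative
        \<i> * of_real \<gamma> - of_real (a * s) + \<i> * F' \<nu> s) (at s)"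
    proof (intro has_vector_derivative_add has_vector_derivative_diff has_vector_derivative_mult_right DF)
      have "((\<lambda>s. \<gamma> * s) has_vector_derivative \<gamma>) (at s)"
        by (auto intro!: derivative_eq_intros simp: has_real_derivative_iff_has_vector_derivative[symmetric])
      from bounded_linear.has_vector_derivative[OF bounded_linear_of_real this]
      show "((\<lambda>x. complex_of_real (\<gamma> * x)) has_vector_derivative complex_of_real \<gamma>) (at s)" .
      have "((\<lambda>s. a * s\<^sup>2 / 2) has_vector_derivative (a * s)) (at s)"
        by (auto intro!: derivative_eq_intros simp: has_real_derivative_iff_has_vector_derivative[symmetric])
      from bounded_linear.has_vector_derivative[OF bounded_linear_of_real this]
      show "((\<lambda>x. complex_of_real (a * x\<^sup>2 / 2)) has_vector_derivative complex_of_real (a * s)) (at s)" .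
    qed simp
    show "(char \<mu> has_vector_derivative (\<i> * of_real \<gamma> - of_real (a * s) + \<i> * F' \<nu> s) * char \<mu> s) (at s)"
      using field_vector_diff_chain_within[OF D1 has_field_derivative_at_within[OF DERIV_exp]]
      by (simp add: o_def \<gamma>[abs_def])
  qed
  have "\<gamma> = 0"
    using eq[of 0] by (simp add: F'_def \<mu>.char_zero)
  with eq[of s] have "\<i> * F' \<mu> s = \<i> * ((\<i> * of_real (a * s) + F' \<nu> s) * char \<mu> s)"
    by (simp add: algebra_simps)
  then show ?thesis unfolding F'_def by (simp only: mult_cancel_left) simp
qed

definition square_bias :: "real measure" where
  "square_bias = density \<mu> (\<lambda>x. ennreal (x\<^sup>2 / V))"

lemma real_distribution_square_bias: "real_distribution square_bias"
proof -
  have "(\<integral>\<^sup>+x. ennreal (x\<^sup>2 / V) \<partial>\<mu>) = ennreal (\<integral>x. x\<^sup>2 / V \<partial>\<mu>)"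
    using square_integrable V_pos by (intro nn_integral_eq_integral) auto
  also have "\<dots> = 1" using variance V_pos by simp
  finally have "prob_space square_bias"
    unfolding square_bias_def by (intro prob_spaceI) (simp add: emeasure_density)
  then interpret prob_space square_bias .
  show ?thesis by (intro real_distribution.intro real_distribution_axioms.intro)
     (unfold_locales, auto simp: square_bias_def)
qed

text \<open>At \<open>s \<noteq> 0\<close> the equation for \<open>\<phi>'\<close> is divided by \<open>\<i> s\<close>; with
  \<open>x (exp (\<i> s x) - 1) = \<i> s x\<^sup>2 \<integral>\<^sub>0\<^sup>1 exp (\<i> s u x) du\<close> both sides become characteristic functions, up to the
  factor \<open>V\<close>. On the right the Gaussian part \<open>a\<close> is the value of the kernel at \<open>0\<close>, that is, the atom
  of \<open>\<zeta>\<close> at the origin.\<close>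

lemma zero_bias_eq: "uniform_multiple square_bias = (\<mu> \<star> uniform_multiple \<zeta>)"
proof (rule Levy_uniqueness)
  note rd = real_distribution_square_bias real_distribution_mu real_distribution_zeta
    real_distribution_uniform_multiple real_distribution_convolution
  show "real_distribution (uniform_multiple square_bias)"
    "real_distribution (\<mu> \<star> uniform_multiple \<zeta>)" by (intro rd)+
  show "char (uniform_multiple square_bias) = char (\<mu> \<star> uniform_multiple \<zeta>)"
  proof
    fix s
    show "char (uniform_multiple square_bias) s = char (\<mu> \<star> uniform_multiple \<zeta>) s"
    proof (cases "s = 0")
      case True
      then show ?thesis by (simp add: real_distribution.char_zero rd)
    next
      case False
      have k: "of_real s * \<i> * (x\<^sup>2 *\<^sub>R expm1_quot (\<i> * of_real (s * x))) =
          of_real x * (exp (of_real x * (\<i> * of_real s)) - 1)" for x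
        using False by (auto simp: expm1_quot_def scaleR_conv_of_real power2_eq_square field_simps)
      have "char (uniform_multiple square_bias) s = (CLINT x|\<mu>. (x\<^sup>2 / V) *\<^sub>R expm1_quot (\<i> * of_real (s * x)))"
        unfolding char_uniform_multiple(1)[OF rd(1)] unfolding square_bias_def
        using V_pos by (subst integral_density) auto
      then have "of_real s * \<i> * of_real V * char (uniform_multiple square_bias) s =
          (CLINT x|\<mu>. of_real s * \<i> * (x\<^sup>2 *\<^sub>R expm1_quot (\<i> * of_real (s * x))))"
        using V_pos by (simp add: scaleR_conv_of_real mult.assoc)
      also have "\<dots> = (\<i> * of_real (a * s) + (\<integral>x. of_real x * (exp (of_real x * (\<i> * of_real s)) - 1) \<partial>\<nu>)) * char \<mu> s"
        unfolding k by (rule char_derivative_equation)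
      also have "(\<integral>x. of_real x * (exp (of_real x * (\<i> * of_real s)) - 1) \<partial>\<nu>) =
          of_real s * \<i> * (\<integral>x. x\<^sup>2 *\<^sub>R expm1_quot (\<i> * of_real (s * x)) \<partial>\<nu>)"
        unfolding k[symmetric] by (rule integral_mult_right_zero)
      also have "(\<i> * of_real (a * s) + \<dots>) = of_real s * \<i> * (a *\<^sub>R expm1_quot (\<i> * of_real (s * 0))
          + (\<integral>x. x\<^sup>2 *\<^sub>R expm1_quot (\<i> * of_real (s * x)) \<partial>\<nu>))"
        by (simp add: expm1_quot_def scaleR_conv_of_real algebra_simps)
      also have "a *\<^sub>R expm1_quot (\<i> * of_real (s * 0)) + (\<integral>x. x\<^sup>2 *\<^sub>R expm1_quot (\<i> * of_real (s * x)) \<partial>\<nu>)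
          = V *\<^sub>R char (uniform_multiple \<zeta>) s"
        unfolding char_uniform_multiple(1)[OF rd(3)]
        by (rule integral_zeta(2)[OF char_uniform_multiple(2)[OF rd(3)], symmetric])
      finally have "of_real s * \<i> * of_real V * char (uniform_multiple square_bias) s =
         of_real s * \<i> * of_real V * (char \<mu> s * char (uniform_multiple \<zeta>) s)"
        by (simp add: scaleR_conv_of_real mult.commute)
      with False V_pos have "char (uniform_multiple square_bias) s = char \<mu> s * char (uniform_multiple \<zeta>) s"
        by (simp only: mult_cancel_left) (simp add: mult.commute)
      then show ?thesis by (simp add: char_convolution rd)
    qed
  qed
qed

end

section \<open>Exponential moments\<close>

context centered_levy_law
begin

text \<open>For \<open>f \<ge> 0\<close> this is the Stein identity \<open>E[X F(X)] = V E[F'(X + U Z)]\<close> with \<open>F' = f\<close> and \<open>F(0) = 0\<close>,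
  valid without any integrability because all terms are nonnegative.\<close>

lemma nn_integral_zero_bias:
  assumes [measurable]: "f \<in> borel_measurable borel"
  shows "(\<integral>\<^sup>+x. ennreal (x\<^sup>2) * (\<integral>\<^sup>+u. f (u * x) \<partial>unif01) \<partial>\<mu>) =
    ennreal V * (\<integral>\<^sup>+x. \<integral>\<^sup>+z. \<integral>\<^sup>+u. f (x + u * z) \<partial>unif01 \<partial>\<zeta> \<partial>\<mu>)"
proof -
  interpret U: prob_space unif01 by (rule prob_space_unif01)
  interpret Z: real_distribution "uniform_multiple \<zeta>"
    by (rule real_distribution_uniform_multiple[OF real_distribution_zeta])
  have "(\<integral>\<^sup>+x. ennreal (x\<^sup>2) * (\<integral>\<^sup>+u. f (u * x) \<partial>unif01) \<partial>\<mu>)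
      = (\<integral>\<^sup>+x. ennreal V * (ennreal (x\<^sup>2 / V) * (\<integral>\<^sup>+u. f (u * x) \<partial>unif01)) \<partial>\<mu>)"
    using V_pos by (simp add: mult.assoc[symmetric] ennreal_mult[symmetric])
  also have "\<dots> = ennreal V * (\<integral>\<^sup>+x. ennreal (x\<^sup>2 / V) * (\<integral>\<^sup>+u. f (u * x) \<partial>unif01) \<partial>\<mu>)"
    by (rule nn_integral_cmult) measurable
  also have "(\<integral>\<^sup>+x. ennreal (x\<^sup>2 / V) * (\<integral>\<^sup>+u. f (u * x) \<partial>unif01) \<partial>\<mu>) =
      (\<integral>\<^sup>+x. \<integral>\<^sup>+u. f (u * x) \<partial>unif01 \<partial>square_bias)"
    unfolding square_bias_def by (rule nn_integral_density[symmetric]) measurable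
  also have "\<dots> = (\<integral>\<^sup>+y. f y \<partial>uniform_multiple square_bias)"
    by (rule nn_integral_uniform_multiple[OF real_distribution_square_bias, symmetric]) measurable
  also have "\<dots> = (\<integral>\<^sup>+x. \<integral>\<^sup>+y. f (x + y) \<partial>uniform_multiple \<zeta> \<partial>\<mu>)"
    unfolding zero_bias_eq
    by (rule nn_integral_convolution) (auto simp: \<mu>.finite_measure_axioms Z.finite_measure_axioms)
  also have "\<dots> = (\<integral>\<^sup>+x. \<integral>\<^sup>+z. \<integral>\<^sup>+u. f (x + u * z) \<partial>unif01 \<partial>\<zeta> \<partial>\<mu>)"
    by (simp add: nn_integral_uniform_multiple[OF real_distribution_zeta])
  finally show ?thesis .
qed

end

locale right_bounded_levy_law = centered_levy_law +
  fixes b :: real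
  assumes b_pos: "0 < b" and jumps_le: "AE x in \<nu>. x \<le> b"
begin

lemma zeta_le: "AE z in \<zeta>. z \<le> b"
proof -
  have "(\<integral>\<^sup>+x. ennreal (x\<^sup>2) * indicator {b<..} x \<partial>\<nu>) = (\<integral>\<^sup>+x. 0 \<partial>\<nu>)"
    using jumps_le by (intro nn_integral_cong_AE) (auto split: split_indicator)
  with nn_integral_zeta[of "indicator {b<..}"] b_pos have "ennreal V * emeasure \<zeta> {b<..} = 0"
    by simp
  with V_pos have "emeasure \<zeta> {b<..} = 0" by simp
  then show ?thesis by (intro AE_I[of _ _ "{b<..}"]) auto
qed

text \<open>Let \<open>g(x) = exp (t min(x, n))\<close>. The zero-bias identity bounds \<open>E[X g(X)]\<close> by \<open>A E[g(X)]\<close> with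
  \<open>A = t V exp (t b)\<close>, because shifting the argument of \<open>g\<close> by \<open>U Z \<le> b\<close> costs at most the factor
  \<open>exp (t b)\<close>. But \<open>x g(x) \<ge> 2A g(x)\<close> as soon as \<open>x \<ge> 2A\<close>, and \<open>g\<close> is at most \<open>exp (2 A t)\<close> below \<open>2A\<close>; so \<open>E[g(X)]\<close>
  is bounded by a constant that does not depend on \<open>n\<close>, and Fatou's lemma concludes.\<close>

lemma integrable_exp:
  assumes t: "0 < t"
  shows "integrable \<mu> (\<lambda>x. exp (t * x))"
proof -
  interpret U: prob_space unif01 by (rule prob_space_unif01)
  define A where "A = t * V * exp (t * b)"
  have A: "0 < A" unfolding A_def using t V_pos by simp
  define C where "C = exp (2 * A * t) * (2 * A + (\<integral>x. \<bar>x\<bar> \<partial>\<mu>)) / A"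
  have bound: "(\<integral>\<^sup>+x. ennreal (exp (t * min x (real n))) \<partial>\<mu>) \<le> ennreal C" for n
  proof -
    define m where "m = (\<lambda>x. min x (real n))"
    define g where "g = (\<lambda>x. exp (t * m x))"
    have [measurable]: "g \<in> borel_measurable borel" "m \<in> borel_measurable borel" unfolding g_def m_def by measurable
    have g_int: "integrable \<mu> g"
      by (rule \<mu>.integrable_const_bound[where B = "exp (t * n)"]) (use t in \<open>auto simp: g_def m_def\<close>)
    have xg_int: "integrable \<mu> (\<lambda>x. x * g x)"
      by (rule Bochner_Integration.integrable_bound[OF integrable_mult_left[OF integrable_id, of "exp (t * n)"]])
         (use t in \<open>auto simp: g_def m_def abs_mult intro!: mult_left_mono\<close>)
    define G where "G = (\<integral>x. g x \<partial>\<mu>)"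
    have G: "(\<integral>\<^sup>+x. ennreal (g x) \<partial>\<mu>) = ennreal G"
      unfolding G_def using g_int by (intro nn_integral_eq_integral) (auto simp: g_def)
    have G0: "0 \<le> G" unfolding G_def by (auto simp: g_def)
    have AE_U: "AE u in unif01. u \<in> {0..1}" by (intro AE_uniform_measureI) auto
    \<comment> \<open>Since \<open>u min(x, n) \<le> min(u x, n)\<close> for \<open>u\<close> in the unit interval, the inner integral of \<open>g\<close> is at
        least an explicit one.\<close>
    have "(\<integral>\<^sup>+x. ennreal (x\<^sup>2 * expm1_quot (t * m x)) \<partial>\<mu>)
        \<le> (\<integral>\<^sup>+x. ennreal (x\<^sup>2) * (\<integral>\<^sup>+u. ennreal (g (u * x)) \<partial>unif01) \<partial>\<mu>)"
    proof (rule nn_integral_mono)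
      fix x
      have "(\<integral>\<^sup>+u. ennreal (exp (u * (t * m x))) \<partial>unif01) \<le> (\<integral>\<^sup>+u. ennreal (g (u * x)) \<partial>unif01)"
      proof (rule nn_integral_mono_AE)
        show "AE u in unif01. ennreal (exp (u * (t * m x))) \<le> ennreal (g (u * x))"
          using AE_U
        proof eventually_elim
          case (elim u)
          have "u * m x \<le> u * x" using elim by (intro mult_left_mono) (auto simp: m_def)
          moreover have "u * m x \<le> u * real n" using elim by (intro mult_left_mono) (auto simp: m_def)
          moreover have "u * real n \<le> real n" using elim by (intro mult_left_le_one_le) auto
          ultimately have "u * m x \<le> m (u * x)" by (auto simp: m_def)
          then have "t * (u * m x) \<le> t * m (u * x)" using t by (intro mult_left_mono) auto
          then show ?case by (simp add: g_def mult_ac)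
        qed
      qed
      then show "ennreal (x\<^sup>2 * expm1_quot (t * m x)) \<le> ennreal (x\<^sup>2) * (\<integral>\<^sup>+u. ennreal (g (u * x)) \<partial>unif01)"
        unfolding nn_integral_exp_unif01 by (simp add: ennreal_mult expm1_quot_real_nonneg mult_left_mono)
    qed
    also have "\<dots> = ennreal V * (\<integral>\<^sup>+x. \<integral>\<^sup>+z. \<integral>\<^sup>+u. ennreal (g (x + u * z)) \<partial>unif01 \<partial>\<zeta> \<partial>\<mu>)"
      by (rule nn_integral_zero_bias) measurable
    also have "\<dots> \<le> ennreal V * (\<integral>\<^sup>+x. ennreal (exp (t * b) * g x) \<partial>\<mu>)"
    proof (intro mult_left_mono nn_integral_mono)
      fix x
      have "(\<integral>\<^sup>+z. \<integral>\<^sup>+u. ennreal (g (x + u * z)) \<partial>unif01 \<partial>\<zeta>) \<le> (\<integral>\<^sup>+z. ennreal (exp (t * b) * g x) \<partial>\<zeta>)"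
      proof (rule nn_integral_mono_AE)
        show "AE z in \<zeta>. (\<integral>\<^sup>+u. ennreal (g (x + u * z)) \<partial>unif01) \<le> ennreal (exp (t * b) * g x)"
          using zeta_le
        proof eventually_elim
          case (elim z)
          have "(\<integral>\<^sup>+u. ennreal (g (x + u * z)) \<partial>unif01) \<le> (\<integral>\<^sup>+u. ennreal (exp (t * b) * g x) \<partial>unif01)"
          proof (rule nn_integral_mono_AE)
            show "AE u in unif01. ennreal (g (x + u * z)) \<le> ennreal (exp (t * b) * g x)"
              using AE_U
            proof eventually_elim
              case u: (elim u)
              have "u * z \<le> u * b" using u elim by (intro mult_left_mono) auto
              also have "\<dots> \<le> b" using u b_pos by (intro mult_left_le_one_le) auto
              finally have "u * z \<le> b" .
              then have "m (x + u * z) \<le> b + m x" using b_pos by (auto simp: m_def)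
              then have "t * m (x + u * z) \<le> t * (b + m x)" using t by (intro mult_left_mono) auto
              then show ?case by (auto simp: g_def exp_add[symmetric] distrib_left intro!: ennreal_leI)
            qed
          qed
          then show ?case by (simp add: U.emeasure_space_1)
        qed
      qed
      then show "(\<integral>\<^sup>+z. \<integral>\<^sup>+u. ennreal (g (x + u * z)) \<partial>unif01 \<partial>\<zeta>) \<le> ennreal (exp (t * b) * g x)"
        by (simp add: \<zeta>.emeasure_space_1 del: \<zeta>.space_eq_univ)
    qed simp
    also have "\<dots> = ennreal (V * exp (t * b) * G)"
      using V_pos G0 unfolding ennreal_mult'[OF exp_ge_zero]
      by (simp add: ennreal_mult nn_integral_cmult G mult.assoc)
    finally have le: "(\<integral>\<^sup>+x. ennreal (x\<^sup>2 * expm1_quot (t * m x)) \<partial>\<mu>) \<le> ennreal (V * exp (t * b) * G)" .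
    have k_int: "integrable \<mu> (\<lambda>x. x\<^sup>2 * expm1_quot (t * m x))"
      using le by (intro integrableI_nonneg) (auto simp: expm1_quot_real_nonneg less_top[symmetric] top_unique)
    \<comment> \<open>Equality where \<open>x \<le> n\<close>; subtracting \<open>x\<close> is free since \<open>\<mu>\<close> is centered.\<close>
    have "(\<integral>x. (x * g x - x) / t \<partial>\<mu>) \<le> (\<integral>x. x\<^sup>2 * expm1_quot (t * m x) \<partial>\<mu>)"
    proof (rule integral_mono)
      show "integrable \<mu> (\<lambda>x. (x * g x - x) / t)" using xg_int integrable_id by auto
      fix x
      show "(x * g x - x) / t \<le> x\<^sup>2 * expm1_quot (t * m x)"
      proof (cases "m x = 0")
        case True
        then show ?thesis by (auto simp: g_def expm1_quot_def)
      next
        case m0: False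
        show ?thesis
        proof (cases "x \<le> n")
          case True
          then show ?thesis using t m0 by (auto simp: g_def expm1_quot_def m_def power2_eq_square field_simps)
        next
          case False
          then have n: "m x = n" "n > 0" "n < x" using m0 by (auto simp: m_def)
          define E where "E = exp (t * n)"
          have "1 \<le> E" using t by (simp add: E_def)
          have "x * (E - 1) * n \<le> x * (E - 1) * x"
            using n \<open>1 \<le> E\<close> by (intro mult_left_mono) auto
          then have "x * (E - 1) * n / (t * n) \<le> x * (E - 1) * x / (t * n)"
            using t by (intro divide_right_mono) auto
          moreover have "(x * g x - x) / t = x * (E - 1) * n / (t * n)"
            using n by (simp add: g_def E_def right_diff_distrib)
          moreover have "x\<^sup>2 * expm1_quot (t * m x) = x * (E - 1) * x / (t * n)"
            using n t by (simp add: expm1_quot_def E_def power2_eq_square)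
          ultimately show ?thesis by simp
        qed
      qed
    qed (rule k_int)
    also have "\<dots> \<le> V * exp (t * b) * G"
    proof -
      have "ennreal (\<integral>x. x\<^sup>2 * expm1_quot (t * m x) \<partial>\<mu>) \<le> ennreal (V * exp (t * b) * G)"
        using le k_int by (subst (asm) nn_integral_eq_integral) (auto simp: expm1_quot_real_nonneg)
      then show ?thesis using V_pos G0 by (subst (asm) ennreal_le_iff) auto
    qed
    finally have "(\<integral>x. x * g x \<partial>\<mu>) / t \<le> V * exp (t * b) * G"
      using xg_int integrable_id mean_0 by simp
    then have xg_le: "(\<integral>x. x * g x \<partial>\<mu>) \<le> A * G" using t by (simp add: A_def field_simps)
    have "2 * A * G = (\<integral>x. 2 * A * g x \<partial>\<mu>)" by (simp add: G_def)
    also have "\<dots> \<le> (\<integral>x. x * g x + exp (2 * A * t) * (2 * A + \<bar>x\<bar>) \<partial>\<mu>)"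
    proof (rule integral_mono)
      show "integrable \<mu> (\<lambda>x. 2 * A * g x)" using g_int by simp
      show "integrable \<mu> (\<lambda>x. x * g x + exp (2 * A * t) * (2 * A + \<bar>x\<bar>))"
        using xg_int integrable_id by auto
      fix x
      show "2 * A * g x \<le> x * g x + exp (2 * A * t) * (2 * A + \<bar>x\<bar>)"
      proof (cases "2 * A \<le> x")
        case True
        then have "2 * A * g x \<le> x * g x" by (intro mult_right_mono) (auto simp: g_def)
        moreover have "0 \<le> exp (2 * A * t) * (2 * A + \<bar>x\<bar>)" using A by simp
        ultimately show ?thesis by linarith
      next
        case False
        have "t * m x \<le> t * (2 * A)" using False t by (intro mult_left_mono) (auto simp: m_def)
        then have "g x \<le> exp (2 * A * t)" by (simp add: g_def mult_ac)
        then have "(2 * A - x) * g x \<le> (2 * A + \<bar>x\<bar>) * exp (2 * A * t)"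
          using False A by (intro mult_mono) (auto simp: g_def)
        then show ?thesis by (simp add: algebra_simps)
      qed
    qed
    also have "\<dots> = (\<integral>x. x * g x \<partial>\<mu>) + exp (2 * A * t) * (2 * A + (\<integral>x. \<bar>x\<bar> \<partial>\<mu>))"
      using xg_int integrable_id \<mu>.prob_space by simp
    finally have "A * G \<le> exp (2 * A * t) * (2 * A + (\<integral>x. \<bar>x\<bar> \<partial>\<mu>))" using xg_le by linarith
    then have "G \<le> C" unfolding C_def using A by (simp add: field_simps)
    then show ?thesis using G by (simp add: g_def m_def ennreal_leI)
  qed
  have "(\<integral>\<^sup>+x. ennreal (exp (t * x)) \<partial>\<mu>) = (\<integral>\<^sup>+x. liminf (\<lambda>n. ennreal (exp (t * min x (real n)))) \<partial>\<mu>)"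
  proof (intro nn_integral_cong)
    fix x
    have "\<forall>\<^sub>F n in sequentially. min x (real n) = x"
      using eventually_ge_at_top[of "nat \<lceil>x\<rceil>"] by eventually_elim (auto simp: min_def nat_le_iff ceiling_le_iff)
    then have "(\<lambda>n. ennreal (exp (t * min x (real n)))) \<longlonglongrightarrow> ennreal (exp (t * x))"
      by (intro tendsto_eventually) (auto elim: eventually_mono)
    from lim_imp_Liminf[OF sequentially_bot this]
    show "ennreal (exp (t * x)) = liminf (\<lambda>n. ennreal (exp (t * min x (real n))))" by (rule sym)
  qed
  also have "\<dots> \<le> liminf (\<lambda>n. \<integral>\<^sup>+x. ennreal (exp (t * min x (real n))) \<partial>\<mu>)"
    by (rule nn_integral_liminf) auto
  also have "\<dots> \<le> liminf (\<lambda>n::nat. ennreal C)"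
    by (intro Liminf_mono always_eventually allI bound)
  also have "\<dots> < \<infinity>" by (simp add: Liminf_const)
  finally show ?thesis by (intro integrableI_nonneg) auto
qed

definition cumulant :: "real \<Rightarrow> real" where
  "cumulant t = a * t\<^sup>2 / 2 + (\<integral>x. exp (x * t) - 1 - x * t \<partial>\<nu>)"

text \<open>On \<open>[0, T]\<close> the exponentials \<open>exp (x t)\<close> are bounded by \<open>exp (b T)\<close> for \<open>\<nu>\<close>-almost every \<open>x\<close>.\<close>

lemma cumulant_derivative_nu:
  assumes t: "t \<in> {0..T}"
  shows "integrable \<nu> (\<lambda>x. exp (x * t) - 1 - x * t)" (is ?th1)
    and "integrable \<nu> (\<lambda>x. x * (exp (x * t) - 1))" (is ?th2)
    and "(cumulant has_field_derivative a * t + (\<integral>x. x * (exp (x * t) - 1) \<partial>\<nu>)) (at t within {0..T})" (is ?th3)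
proof -
  have S: "convex {0..T}" "0 \<in> {0..T}" using t by auto
  have bd: "AE x in \<nu>. \<forall>z\<in>{0..T}. norm (exp (of_real x * z)) \<le> exp (b * T)"
    using jumps_le
  proof eventually_elim
    case (elim x)
    have "x * z \<le> b * T" if "z \<in> {0..T}" for z
    proof -
      have "x * z \<le> b * z" using elim that by (intro mult_right_mono) auto
      also have "\<dots> \<le> b * T" using that b_pos by (intro mult_left_mono) auto
      finally show ?thesis .
    qed
    then show ?case by simp
  qed
  have g: "integrable \<nu> (\<lambda>x. x\<^sup>2 * exp (b * T))" using square_integrable_nu by simp
  note * = exp_moment_has_derivative[OF S sets_nu bd g t, simplified]
  show ?th1 ?th2 by (rule *)+
  show ?th3
    unfolding cumulant_def[abs_def]
    by (rule derivative_eq_intros refl *(3) | simp)+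
qed

lemma exp_moment_derivative_mu:
  assumes t: "t \<in> {0..T}"
  shows "integrable \<mu> (\<lambda>x. x * (exp (x * t) - 1))" (is ?th2)
    and "((\<lambda>t. \<integral>x. exp (x * t) \<partial>\<mu>) has_field_derivative (\<integral>x. x * (exp (x * t) - 1) \<partial>\<mu>)) (at t within {0..T})" (is ?th3)
proof -
  have S: "convex {0..T}" "0 \<in> {0..T}" using t by auto
  have bd: "AE x in \<mu>. \<forall>z\<in>{0..T}. norm (exp (of_real x * z)) \<le> 1 + exp (T * x)"
  proof (intro AE_I2 ballI)
    fix x z assume z: "z \<in> {0..T}"
    show "norm (exp (of_real x * z)) \<le> 1 + exp (T * x)"
    proof (cases "0 \<le> x")
      case True
      then have "x * z \<le> T * x" using z by (metis atLeastAtMost_iff mult.commute mult_left_mono)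
      then show ?thesis by (simp add: add_increasing)
    next
      case False
      then have "x * z \<le> 0" using z by (auto intro: mult_nonpos_nonneg)
      then show ?thesis by (simp add: add_increasing2)
    qed
  qed
  have g: "integrable \<mu> (\<lambda>x. x\<^sup>2 * (1 + exp (T * x)))"
  proof (rule Bochner_Integration.integrable_bound)
    show "integrable \<mu> (\<lambda>x. 2 * x\<^sup>2 + 2 * exp ((T + 1) * x))"
      using square_integrable integrable_exp[of "T + 1"] t by auto
    have "x\<^sup>2 * exp (T * x) \<le> x\<^sup>2 + 2 * exp ((T + 1) * x)" for x
    proof (cases "0 \<le> x")
      case True
      have "x\<^sup>2 \<le> 2 * exp x" using exp_lower_Taylor_quadratic[OF True] True by (simp add: field_simps)
      then have "x\<^sup>2 * exp (T * x) \<le> 2 * exp x * exp (T * x)" by (intro mult_right_mono) auto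
      also have "\<dots> = 2 * exp ((T + 1) * x)" by (simp add: exp_add[symmetric] algebra_simps)
      finally show ?thesis by (simp add: add_increasing)
    next
      case False
      then have "T * x \<le> 0" using t by (auto intro: mult_nonneg_nonpos)
      then have "x\<^sup>2 * exp (T * x) \<le> x\<^sup>2 * 1" by (intro mult_left_mono) auto
      then show ?thesis by (simp add: add_increasing2)
    qed
    then show "AE x in \<mu>. norm (x\<^sup>2 * (1 + exp (T * x))) \<le> norm (2 * x\<^sup>2 + 2 * exp ((T + 1) * x))"
      by (auto simp: distrib_left add_nonneg_nonneg intro!: AE_I2)
  qed auto
  note * = exp_moment_has_derivative[OF S \<mu>.events_eq_borel bd g, simplified]
  show ?th2 by (rule *(2)) (use t in auto)
  have eq: "(\<integral>x. exp (x * s) \<partial>\<mu>) = 1 + (\<integral>x. exp (x * s) - 1 - x * s \<partial>\<mu>)" if "s \<in> {0..T}" for s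
  proof -
    have "(\<integral>x. exp (x * s) \<partial>\<mu>) = (\<integral>x. (exp (x * s) - 1 - x * s) + (1 + x * s) \<partial>\<mu>)" by simp
    also have "\<dots> = (\<integral>x. exp (x * s) - 1 - x * s \<partial>\<mu>) + (\<integral>x. 1 + x * s \<partial>\<mu>)"
      using *(1)[of s] that integrable_id by (intro Bochner_Integration.integral_add) auto
    also have "(\<integral>x. 1 + x * s \<partial>\<mu>) = 1" using integrable_id mean_0 \<mu>.prob_space by simp
    finally show ?thesis by simp
  qed
  have "((\<lambda>s. 1 + (\<integral>x. exp (x * s) - 1 - x * s \<partial>\<mu>)) has_field_derivative (\<integral>x. x * (exp (x * t) - 1) \<partial>\<mu>)) (at t within {0..T})"
    by (rule derivative_eq_intros refl *(3) | use t in simp)+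
  then show ?th3
    by (rule has_field_derivative_transform_within[OF _ zero_less_one t]) (use eq in auto)
qed

lemma square_times_expm1_quot:
  "t \<noteq> 0 \<Longrightarrow> x\<^sup>2 * expm1_quot (t * x) = x * (exp (x * t) - 1) / (t::real)"
  by (auto simp: expm1_quot_def power2_eq_square mult_ac)

text \<open>The equation \<open>m' = k' m\<close>: the real counterpart of \<open>\<phi>' = \<psi>' \<phi>\<close>, obtained from the zero-bias identity for
  \<open>f(y) = exp (t y)\<close>.\<close>

lemma mgf_derivative_equation:
  assumes t: "0 \<le> t"
  shows "(\<integral>x. x * (exp (x * t) - 1) \<partial>\<mu>) =
    (a * t + (\<integral>x. x * (exp (x * t) - 1) \<partial>\<nu>)) * (\<integral>x. exp (x * t) \<partial>\<mu>)"
proof (cases "t = 0")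
  case False
  with t have t: "0 < t" by simp
  have nonneg: "0 \<le> x * (exp (x * t) - 1) / t" for x
    using t by (subst square_times_expm1_quot[symmetric]) (auto simp: expm1_quot_real_nonneg)
  have int: "integrable L (\<lambda>x. x * (exp (x * t) - 1) / t)" if "L = \<mu> \<or> L = \<nu>" for L
    using that exp_moment_derivative_mu(1)[of t t] cumulant_derivative_nu(2)[of t t] t by auto
  have nn: "(\<integral>\<^sup>+x. ennreal (x\<^sup>2) * ennreal (expm1_quot (t * x)) \<partial>L) = ennreal ((\<integral>x. x * (exp (x * t) - 1) \<partial>L) / t)"
    if L: "L = \<mu> \<or> L = \<nu>" for L
  proof -
    have "(\<integral>\<^sup>+x. ennreal (x\<^sup>2) * ennreal (expm1_quot (t * x)) \<partial>L) = (\<integral>\<^sup>+x. ennreal (x * (exp (x * t) - 1) / t) \<partial>L)"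
      using t by (intro nn_integral_cong) (simp add: ennreal_mult[symmetric] expm1_quot_real_nonneg square_times_expm1_quot)
    then show ?thesis using int[OF L] nonneg by (simp add: nn_integral_eq_integral)
  qed
  have int_exp: "integrable \<mu> (\<lambda>x. exp (x * t))" using integrable_exp[OF t] by (simp add: mult.commute)
  have "ennreal ((\<integral>x. x * (exp (x * t) - 1) \<partial>\<mu>) / t) =
      (\<integral>\<^sup>+x. ennreal (x\<^sup>2) * (\<integral>\<^sup>+u. ennreal (exp (t * (u * x))) \<partial>unif01) \<partial>\<mu>)"
    unfolding mult.left_commute[of t] nn_integral_exp_unif01 by (simp add: nn)
  also have "\<dots> = ennreal V * (\<integral>\<^sup>+x. \<integral>\<^sup>+z. \<integral>\<^sup>+u. ennreal (exp (t * (x + u * z))) \<partial>unif01 \<partial>\<zeta> \<partial>\<mu>)"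
    by (rule nn_integral_zero_bias) measurable
  also have "\<dots> = ennreal V * (\<integral>\<^sup>+x. ennreal (exp (x * t)) * (\<integral>\<^sup>+z. ennreal (expm1_quot (t * z)) \<partial>\<zeta>) \<partial>\<mu>)"
  proof -
    have "(\<integral>\<^sup>+u. ennreal (exp (t * (x + u * z))) \<partial>unif01) = ennreal (exp (x * t)) * ennreal (expm1_quot (t * z))" for x z
      unfolding nn_integral_exp_unif01[symmetric]
      by (subst nn_integral_cmult[symmetric]) (auto simp: ennreal_mult[symmetric] exp_add[symmetric] algebra_simps)
    then show ?thesis by (simp add: nn_integral_cmult)
  qed
  also have "\<dots> = (\<integral>\<^sup>+x. ennreal (exp (x * t)) \<partial>\<mu>) * (ennreal V * (\<integral>\<^sup>+z. ennreal (expm1_quot (t * z)) \<partial>\<zeta>))"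
    by (simp add: nn_integral_multc mult_ac)
  also have "ennreal V * (\<integral>\<^sup>+z. ennreal (expm1_quot (t * z)) \<partial>\<zeta>) = ennreal (a + (\<integral>x. x * (exp (x * t) - 1) \<partial>\<nu>) / t)"
  proof -
    have "0 \<le> (\<integral>x. x * (exp (x * t) - 1) \<partial>\<nu>) / t"
      using nonneg by (subst integral_divide_zero[symmetric]) (rule Bochner_Integration.integral_nonneg)
    then show ?thesis using a_nonneg
      by (subst nn_integral_zeta) (auto simp: nn expm1_quot_def[of 0] ennreal_plus[symmetric] simp del: ennreal_plus)
  qed
  also have "(\<integral>\<^sup>+x. ennreal (exp (x * t)) \<partial>\<mu>) = ennreal (\<integral>x. exp (x * t) \<partial>\<mu>)"
    using int_exp by (intro nn_integral_eq_integral) auto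
  finally have "ennreal ((\<integral>x. x * (exp (x * t) - 1) \<partial>\<mu>) / t) =
     ennreal ((\<integral>x. exp (x * t) \<partial>\<mu>) * (a + (\<integral>x. x * (exp (x * t) - 1) \<partial>\<nu>) / t))"
    by (simp add: ennreal_mult')
  moreover have "0 \<le> (\<integral>x. x * (exp (x * t) - 1) \<partial>L) / t" for L
    using nonneg by (subst integral_divide_zero[symmetric]) (rule Bochner_Integration.integral_nonneg)
  ultimately have "(\<integral>x. x * (exp (x * t) - 1) \<partial>\<mu>) / t = (\<integral>x. exp (x * t) \<partial>\<mu>) * (a + (\<integral>x. x * (exp (x * t) - 1) \<partial>\<nu>) / t)"
    using a_nonneg by (subst (asm) ennreal_inj) auto
  then show ?thesis using t by (simp add: field_simps)
qed simp

theorem exp_moment_eq_exp_cumulant: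
  assumes t: "0 \<le> t"
  shows "(\<integral>x. exp (x * t) \<partial>\<mu>) = exp (cumulant t)"
proof -
  have "\<exists>c. \<forall>s\<in>{0..t}. (\<integral>x. exp (x * s) \<partial>\<mu>) * exp (- cumulant s) = c"
  proof (rule has_field_derivative_zero_constant)
    fix s assume s: "s \<in> {0..t}"
    let ?m = "\<integral>x. exp (x * s) \<partial>\<mu>" and ?k = "a * s + (\<integral>x. x * (exp (x * s) - 1) \<partial>\<nu>)"
    have "((\<lambda>s. exp (- cumulant s)) has_field_derivative exp (- cumulant s) * - ?k) (at s within {0..t})"
      by (rule derivative_eq_intros cumulant_derivative_nu(3)[OF s] refl)+
    from DERIV_mult[OF exp_moment_derivative_mu(2)[OF s] this]
    show "((\<lambda>s. (\<integral>x. exp (x * s) \<partial>\<mu>) * exp (- cumulant s)) has_field_derivative 0) (at s within {0..t})"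
      unfolding mgf_derivative_equation[OF atLeastAtMost_iff[THEN iffD1, THEN conjunct1, OF s]]
      by (simp add: algebra_simps)
  qed simp
  then obtain c where c: "\<And>s. s \<in> {0..t} \<Longrightarrow> (\<integral>x. exp (x * s) \<partial>\<mu>) * exp (- cumulant s) = c" by blast
  from c[of 0] t have "c = 1" using \<mu>.prob_space by (simp add: cumulant_def)
  with c[of t] t show ?thesis by (simp add: exp_minus field_simps)
qed

end

section \<open>The moment generating function of \<open>R\<close>\<close>

text \<open>The moment generating function of \<open>Beta(1,2)\<close> at \<open>y\<close>.\<close>

definition expm2_quot :: "real \<Rightarrow> real" where
  "expm2_quot y = (if y = 0 then 1 else 2 * (exp y - 1 - y) / y\<^sup>2)"

lemma borel_measurable_expm2_quot [measurable]: "expm2_quot \<in> borel_measurable borel"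
  unfolding expm2_quot_def by measurable

lemma nn_integral_beta12:
  assumes [measurable]: "f \<in> borel_measurable borel"
  shows "(\<integral>\<^sup>+u. ennreal (2 * (1 - u) * indicator {0<..<1} u) * ennreal (f u) \<partial>lborel) =
    (\<integral>\<^sup>+u. ennreal (2 * (1 - u) * f u) * indicator {0..1::real} u \<partial>lborel)"
proof (rule nn_integral_cong_AE)
  have "AE u in lborel. u \<noteq> (0::real)" by (rule AE_lborel_singleton)
  then show "AE u in lborel. ennreal (2 * (1 - u) * indicator {0<..<1} u) * ennreal (f u) =
      ennreal (2 * (1 - u) * f u) * indicator {0..1} u"
    by eventually_elim (auto simp: indicator_def ennreal_mult'[symmetric])
qed

lemma nn_integral_exp_beta12:
  "(\<integral>\<^sup>+u. ennreal (2 * (1 - u) * indicator {0<..<1} u) * ennreal (exp (u * y)) \<partial>lborel) = ennreal (expm2_quot y)"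
proof (subst nn_integral_beta12, measurable, cases "y = 0")
  case True
  have "(\<integral>\<^sup>+u. ennreal (2 * (1 - u) * exp (u * y)) * indicator {0..1::real} u \<partial>lborel) =
      ennreal ((2 * 1 - 1\<^sup>2) - (2 * 0 - 0\<^sup>2))"
    using True by (intro nn_integral_FTC_Icc) (auto intro!: derivative_eq_intros)
  then show "(\<integral>\<^sup>+u. ennreal (2 * (1 - u) * exp (u * y)) * indicator {0..1::real} u \<partial>lborel) = ennreal (expm2_quot y)"
    using True by (simp add: expm2_quot_def)
next
  case False
  define F where "F = (\<lambda>u. 2 * (1 - u) * exp (u * y) / y + 2 * exp (u * y) / y\<^sup>2)"
  have "(\<integral>\<^sup>+u. ennreal (2 * (1 - u) * exp (u * y)) * indicator {0..1::real} u \<partial>lborel) = ennreal (F 1 - F 0)"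
  proof (intro nn_integral_FTC_Icc)
    show "DERIV F u :> 2 * (1 - u) * exp (u * y)" for u
      unfolding F_def using False
      by (auto intro!: derivative_eq_intros simp: power2_eq_square field_simps)
  qed auto
  also have "F 1 - F 0 = expm2_quot y"
    using False by (simp add: F_def expm2_quot_def power2_eq_square field_simps)
  finally show "(\<integral>\<^sup>+u. ennreal (2 * (1 - u) * exp (u * y)) * indicator {0..1::real} u \<partial>lborel) = ennreal (expm2_quot y)" .
qed

lemma expm2_quot_nonneg: "0 \<le> expm2_quot y"
proof -
  have "0 \<le> exp y - 1 - y" using exp_ge_add_one_self[of y] by linarith
  then show ?thesis unfolding expm2_quot_def by simp
qed

lemma expm2_quot_le:
  assumes "y \<le> c" "0 \<le> c"
  shows "expm2_quot y \<le> exp c"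
proof -
  have "ennreal (expm2_quot y) \<le>
      (\<integral>\<^sup>+u. ennreal (exp c) * (ennreal (2 * (1 - u) * indicator {0<..<1} u) * ennreal (exp (u * 0))) \<partial>lborel)"
    unfolding nn_integral_exp_beta12[symmetric]
  proof (rule nn_integral_mono)
    fix u :: real
    have "u * y \<le> c" if "0 < u" "u < 1"
    proof -
      have "u * y \<le> u * c" using that assms by (intro mult_left_mono) auto
      also have "\<dots> \<le> c" using that assms by (intro mult_left_le_one_le) auto
      finally show ?thesis .
    qed
    then have "2 * (1 - u) * indicator {0<..<1} u * exp (u * y) \<le> exp c * (2 * (1 - u) * indicator {0<..<1} u)"
      by (auto simp: indicator_def intro!: mult_right_mono)
    then show "ennreal (2 * (1 - u) * indicator {0<..<1} u) * ennreal (exp (u * y))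
      \<le> ennreal (exp c) * (ennreal (2 * (1 - u) * indicator {0<..<1} u) * ennreal (exp (u * 0)))"
      by (simp add: ennreal_mult'[symmetric] ennreal_mult''[symmetric] ennreal_leI)
  qed
  also have "\<dots> = ennreal (exp c)"
    by (subst nn_integral_cmult, measurable, subst nn_integral_exp_beta12) (simp add: expm2_quot_def)
  finally show ?thesis by simp
qed

text \<open>Only the part \<open>[1 - d, 1]\<close> of the unit interval is kept; it has mass \<open>d\<^sup>2\<close> under \<open>Beta(1,2)\<close>.\<close>

lemma expm2_quot_ge:
  assumes "0 \<le> y" "0 \<le> d" "d \<le> 1"
  shows "d\<^sup>2 * exp ((1 - d) * y) \<le> expm2_quot y"
proof -
  have "(\<integral>\<^sup>+u. ennreal (2 * (1 - u) * exp ((1 - d) * y)) * indicator {1 - d..1} u \<partial>lborel)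
      = ennreal ((2 * 1 - 1\<^sup>2) * exp ((1 - d) * y) - (2 * (1 - d) - (1 - d)\<^sup>2) * exp ((1 - d) * y))"
    using assms by (intro nn_integral_FTC_Icc) (auto intro!: derivative_eq_intros)
  also have "(2 * 1 - 1\<^sup>2) * exp ((1 - d) * y) - (2 * (1 - d) - (1 - d)\<^sup>2) * exp ((1 - d) * y) = d\<^sup>2 * exp ((1 - d) * y)"
    by (simp add: power2_eq_square algebra_simps)
  finally have "ennreal (d\<^sup>2 * exp ((1 - d) * y))
      = (\<integral>\<^sup>+u. ennreal (2 * (1 - u) * exp ((1 - d) * y)) * indicator {1 - d..1} u \<partial>lborel)" ..
  also have "\<dots> \<le> (\<integral>\<^sup>+u. ennreal (2 * (1 - u) * exp (u * y)) * indicator {0..1::real} u \<partial>lborel)"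
    using assms by (intro nn_integral_mono)
      (auto simp: indicator_def intro!: ennreal_leI mult_left_mono mult_right_mono)
  also have "\<dots> = ennreal (expm2_quot y)"
    by (rule trans[OF nn_integral_beta12[symmetric] nn_integral_exp_beta12]) measurable
  finally show ?thesis by (simp add: expm2_quot_nonneg)
qed

lemma mgf_beta12_multiple:
  assumes N: "prob_space N" and Z [measurable]: "Z \<in> borel_measurable N"
    and B: "distributed N lborel B (\<lambda>x. ennreal (2 * (1 - x) * indicator {0<..<1} x))"
    and indep: "prob_space.indep_var N borel B borel Z"
  shows "mgf N (\<lambda>w. B w * Z w) t = (\<integral>\<^sup>+z. ennreal (expm2_quot (t * z)) \<partial>distr N borel Z)"
proof -
  interpret N: prob_space N by fact
  have [measurable]: "B \<in> borel_measurable N" using distributed_measurable[OF B] by simp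
  interpret DB: prob_space "distr N borel B" by (rule N.prob_space_distr) simp
  interpret DZ: prob_space "distr N borel Z" by (rule N.prob_space_distr) simp
  interpret P: pair_prob_space "distr N borel B" "distr N borel Z" ..
  have joint: "distr N borel B \<Otimes>\<^sub>M distr N borel Z = distr N (borel \<Otimes>\<^sub>M borel) (\<lambda>w. (B w, Z w))"
    using indep by (simp add: N.indep_var_distribution_eq)
  have "mgf N (\<lambda>w. B w * Z w) t = (\<integral>\<^sup>+p. ennreal (exp (t * (fst p * snd p))) \<partial>(distr N borel B \<Otimes>\<^sub>M distr N borel Z))"
    unfolding mgf_def joint by (subst nn_integral_distr) auto
  also have "\<dots> = (\<integral>\<^sup>+z. \<integral>\<^sup>+u. ennreal (exp (t * (u * z))) \<partial>distr N borel B \<partial>distr N borel Z)"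
    by (subst P.nn_integral_snd[symmetric]) auto
  also have "\<dots> = (\<integral>\<^sup>+z. ennreal (expm2_quot (t * z)) \<partial>distr N borel Z)"
  proof (rule nn_integral_cong)
    fix z
    have "(\<integral>\<^sup>+u. ennreal (exp (t * (u * z))) \<partial>distr N borel B) = (\<integral>\<^sup>+w. ennreal (exp (B w * (t * z))) \<partial>N)"
      by (simp add: nn_integral_distr mult_ac)
    also have "\<dots> = ennreal (expm2_quot (t * z))"
      unfolding nn_integral_exp_beta12[symmetric] by (rule distributed_nn_integral[OF B, symmetric]) simp
    finally show "(\<integral>\<^sup>+u. ennreal (exp (t * (u * z))) \<partial>distr N borel B) = ennreal (expm2_quot (t * z))" .
  qed
  finally show ?thesis .
qed

context right_bounded_levy_law
begin

text \<open>The kernel satisfies \<open>(t\<^sup>2/2) x\<^sup>2 expm2_quot (t x) = exp (t x) - 1 - t x\<close>, and the atom of \<open>\<zeta>\<close> at \<open>0\<close>, where it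
  equals \<open>1\<close>, contributes the Gaussian term \<open>a t\<^sup>2/2\<close>.\<close>

lemma cumulant_eq_mgf:
  assumes t: "0 < t"
  shows "ennreal (cumulant t) = ennreal (V * t\<^sup>2 / 2) * (\<integral>\<^sup>+z. ennreal (expm2_quot (t * z)) \<partial>\<zeta>)"
proof -
  have sq: "t\<^sup>2 / 2 * (x\<^sup>2 * expm2_quot (t * x)) = exp (x * t) - 1 - x * t" for x
    using t by (auto simp: expm2_quot_def power_mult_distrib field_simps)
  have "ennreal (V * t\<^sup>2 / 2) * (\<integral>\<^sup>+z. ennreal (expm2_quot (t * z)) \<partial>\<zeta>)
      = ennreal (t\<^sup>2 / 2) * (ennreal V * (\<integral>\<^sup>+z. ennreal (expm2_quot (t * z)) \<partial>\<zeta>))"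
    using V_pos by (simp add: mult.assoc[symmetric] ennreal_mult[symmetric] mult.commute)
  also have "\<dots> = ennreal (t\<^sup>2 / 2) * (ennreal a + (\<integral>\<^sup>+x. ennreal (x\<^sup>2) * ennreal (expm2_quot (t * x)) \<partial>\<nu>))"
    by (subst nn_integral_zeta) (auto simp: expm2_quot_def[of 0])
  also have "\<dots> = ennreal (t\<^sup>2 / 2) * ennreal a +
      ennreal (t\<^sup>2 / 2) * (\<integral>\<^sup>+x. ennreal (x\<^sup>2) * ennreal (expm2_quot (t * x)) \<partial>\<nu>)"
    by (rule distrib_left)
  also have "ennreal (t\<^sup>2 / 2) * ennreal a = ennreal (a * t\<^sup>2 / 2)"
    using a_nonneg by (simp add: ennreal_mult[symmetric] mult.commute)
  also have "ennreal (t\<^sup>2 / 2) * (\<integral>\<^sup>+x. ennreal (x\<^sup>2) * ennreal (expm2_quot (t * x)) \<partial>\<nu>)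
      = (\<integral>\<^sup>+x. ennreal (t\<^sup>2 / 2 * (x\<^sup>2 * expm2_quot (t * x))) \<partial>\<nu>)"
    by (subst nn_integral_cmult[symmetric])
       (auto intro!: nn_integral_cong simp: ennreal_mult[symmetric] expm2_quot_nonneg simp del: times_divide_eq_left)
  also have "(\<integral>\<^sup>+x. ennreal (t\<^sup>2 / 2 * (x\<^sup>2 * expm2_quot (t * x))) \<partial>\<nu>) = ennreal (\<integral>x. exp (x * t) - 1 - x * t \<partial>\<nu>)"
    unfolding sq using cumulant_derivative_nu(1)[of t t] t
    by (intro nn_integral_eq_integral) (auto simp: exp_ge_add_one_self diff_diff_eq)
  also have "ennreal (a * t\<^sup>2 / 2) + \<dots> = ennreal (cumulant t)"
    unfolding cumulant_def using a_nonneg exp_ge_add_one_self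
    by (subst ennreal_plus) (auto simp: diff_diff_eq intro!: Bochner_Integration.integral_nonneg)
  finally show ?thesis ..
qed

lemma mgf_zeta_le:
  assumes "0 \<le> t"
  shows "(\<integral>\<^sup>+z. ennreal (expm2_quot (t * z)) \<partial>\<zeta>) \<le> ennreal (exp (b * t))"
proof -
  have "(\<integral>\<^sup>+z. ennreal (expm2_quot (t * z)) \<partial>\<zeta>) \<le> (\<integral>\<^sup>+z. ennreal (exp (b * t)) \<partial>\<zeta>)"
  proof (rule nn_integral_mono_AE)
    show "AE z in \<zeta>. ennreal (expm2_quot (t * z)) \<le> ennreal (exp (b * t))"
      using zeta_le
    proof eventually_elim
      case (elim z)
      then show ?case using assms b_pos
        by (intro ennreal_leI expm2_quot_le) (auto simp: mult.commute[of b] intro: mult_left_mono)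
    qed
  qed
  then show ?thesis using \<zeta>.emeasure_space_1 by simp
qed

text \<open>With \<open>c < e < b\<close> and \<open>(1 - d) e = c\<close>, the event that the beta variable exceeds \<open>1 - d\<close> and \<open>Z\<close> exceeds
  \<open>e\<close> has positive probability, and \<open>R > c\<close> there.\<close>

lemma mgf_zeta_ge:
  assumes c: "0 < c" "c < b" and charge: "\<And>d. d < b \<Longrightarrow> 0 < emeasure \<nu> {d<..}"
  shows "\<exists>p>0. \<forall>t\<ge>0. ennreal (p * exp (c * t)) \<le> (\<integral>\<^sup>+z. ennreal (expm2_quot (t * z)) \<partial>\<zeta>)"
proof -
  define e where "e = (b + c) / 2"
  have e: "0 < e" "c < e" "e < b" using c by (auto simp: e_def)
  define d where "d = 1 - c / e"
  have d: "0 < d" "d \<le> 1" "(1 - d) * e = c" using c e by (auto simp: d_def)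
  have "0 < ennreal (e\<^sup>2) * emeasure \<nu> {e<..}"
    using charge[OF e(3)] e(1) by (simp add: ennreal_zero_less_mult_iff)
  also have "\<dots> = (\<integral>\<^sup>+x. ennreal (e\<^sup>2) * indicator {e<..} x \<partial>\<nu>)"
    by (simp add: nn_integral_cmult)
  also have "\<dots> \<le> (\<integral>\<^sup>+x. ennreal (x\<^sup>2) * indicator {e<..} x \<partial>\<nu>)"
    using e(1) by (intro nn_integral_mono) (auto simp: indicator_def intro!: ennreal_leI power_mono)
  also have "\<dots> = ennreal V * emeasure \<zeta> {e<..}"
    using nn_integral_zeta[of "indicator {e<..}"] e(1) by simp
  finally have "0 < emeasure \<zeta> {e<..}" by (auto simp: ennreal_zero_less_mult_iff)
  then have m: "0 < measure \<zeta> {e<..}" by (simp add: \<zeta>.emeasure_eq_measure)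
  show ?thesis
  proof (intro exI[of _ "d\<^sup>2 * measure \<zeta> {e<..}"] conjI allI impI)
    show "0 < d\<^sup>2 * measure \<zeta> {e<..}" using d(1) m by simp
    fix t :: real assume t: "0 \<le> t"
    have "ennreal (d\<^sup>2 * measure \<zeta> {e<..} * exp (c * t)) = ennreal (d\<^sup>2 * exp (c * t)) * emeasure \<zeta> {e<..}"
      by (simp add: \<zeta>.emeasure_eq_measure ennreal_mult[symmetric] mult_ac)
    also have "\<dots> = (\<integral>\<^sup>+z. ennreal (d\<^sup>2 * exp (c * t)) * indicator {e<..} z \<partial>\<zeta>)"
      by (simp add: nn_integral_cmult)
    also have "\<dots> \<le> (\<integral>\<^sup>+z. ennreal (expm2_quot (t * z)) \<partial>\<zeta>)"
    proof (rule nn_integral_mono)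
      fix z
      show "ennreal (d\<^sup>2 * exp (c * t)) * indicator {e<..} z \<le> ennreal (expm2_quot (t * z))"
      proof (cases "e < z")
        case True
        have "c * t = (1 - d) * (t * e)" using d(3) by (simp add: mult_ac)
        also have "\<dots> \<le> (1 - d) * (t * z)"
          using True t d by (intro mult_left_mono) auto
        finally have "d\<^sup>2 * exp (c * t) \<le> d\<^sup>2 * exp ((1 - d) * (t * z))" by (intro mult_left_mono) auto
        also have "\<dots> \<le> expm2_quot (t * z)" using True e(1) t d by (intro expm2_quot_ge) auto
        finally show ?thesis using True by (simp add: ennreal_leI)
      qed simp
    qed
    finally show "ennreal (d\<^sup>2 * measure \<zeta> {e<..} * exp (c * t)) \<le> (\<integral>\<^sup>+z. ennreal (expm2_quot (t * z)) \<partial>\<zeta>)" .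
  qed
qed

end

text \<open>The complement of the support is a union of open null sets, hence null by the Lindelof property.\<close>

lemma AE_le_of_measure_supp:
  assumes \<nu>: "sets \<nu> = sets borel" and b: "0 < b"
    and supp: "(SUP x\<in>{x. 0 < x \<and> x \<in> measure_supp \<nu>}. ereal x) = ereal b"
  shows "AE x in \<nu>. x \<le> b" and "\<And>d. d < b \<Longrightarrow> 0 < emeasure \<nu> {d<..}"
proof -
  define F where "F = {U. open U \<and> emeasure \<nu> U = 0}"
  obtain F' where F': "F' \<subseteq> F" "countable F'" "\<Union>F' = \<Union>F"
    using Lindelof[of F] by (auto simp: F_def)
  have null: "U \<in> null_sets \<nu>" if "U \<in> F" for U
    using that \<nu> by (auto simp: F_def null_sets_def)
  have "(\<Union>U\<in>F'. U) \<in> null_sets \<nu>"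
    using F' by (intro null_sets_UN') (auto intro: null)
  then have N: "\<Union>F \<in> null_sets \<nu>" using F' by simp
  show "AE x in \<nu>. x \<le> b"
  proof (rule AE_I'[OF N])
    show "{x \<in> space \<nu>. \<not> x \<le> b} \<subseteq> \<Union>F"
    proof
      fix x assume "x \<in> {x \<in> space \<nu>. \<not> x \<le> b}"
      then have x: "b < x" by auto
      have "x \<notin> measure_supp \<nu>"
      proof
        assume "x \<in> measure_supp \<nu>"
        then have "ereal x \<le> ereal b" unfolding supp[symmetric] using x b by (intro SUP_upper) auto
        with x show False by simp
      qed
      then show "x \<in> \<Union>F" unfolding measure_supp_def F_def by (auto simp: not_gr_zero)
    qed
  qed
  fix d assume "d < b"
  then have "ereal d < (SUP x\<in>{x. 0 < x \<and> x \<in> measure_supp \<nu>}. ereal x)" by (simp add: supp)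
  then obtain x where "x \<in> measure_supp \<nu>" "d < x" by (auto simp: less_SUP_iff)
  then show "0 < emeasure \<nu> {d<..}" by (auto simp: measure_supp_def)
qed

section \<open>Functions of exponential rate \<open>b\<close>\<close>

text \<open>The function \<open>r\<close> stands for \<open>M\<^sub>R\<close>; only its two exponential bounds matter in what follows.\<close>

locale exponential_rate =
  fixes r :: "real \<Rightarrow> real" and b :: real
  assumes rate_pos: "0 < b"
    and upper: "\<And>t. 0 \<le> t \<Longrightarrow> r t \<le> exp (b * t)"
    and lower: "\<And>c. 0 < c \<Longrightarrow> c < b \<Longrightarrow> \<exists>p>0. \<forall>t\<ge>0. p * exp (c * t) \<le> r t"
begin

lemma r_pos: "0 \<le> t \<Longrightarrow> 0 < r t"
proof -
  assume t: "0 \<le> t"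
  obtain p where "p > 0" "p * exp (b / 2 * t) \<le> r t"
    using lower[of "b / 2"] rate_pos t by auto
  then show ?thesis by (smt (verit) exp_gt_zero mult_pos_pos)
qed

text \<open>A rate between \<open>c\<close> and \<open>b\<close> leaves room to absorb the constant \<open>p\<close>.\<close>

lemma lower_below:
  assumes c: "c < b"
  obtains d p where "0 < d" "c < d" "d < b" "0 < p" "p \<le> 1" "\<And>t. 0 \<le> t \<Longrightarrow> p * exp (d * t) \<le> r t"
proof -
  define d where "d = (max c 0 + b) / 2"
  have d: "0 < d" "c < d" "d < b" using c rate_pos by (auto simp: d_def max_def)
  then obtain p where p: "p > 0" "\<And>t. 0 \<le> t \<Longrightarrow> p * exp (d * t) \<le> r t"
    using lower by blast
  have "p \<le> 1" using p(2)[of 0] upper[of 0] by simp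
  with d p that show ?thesis by blast
qed

lemma ln_div_tendsto: "((\<lambda>t. ln (r t) / t) \<longlongrightarrow> b) at_top"
proof (rule order_tendstoI)
  fix c assume "c < b"
  then obtain d p where d: "0 < d" "c < d" "d < b" and p: "0 < p" "\<And>t. 0 \<le> t \<Longrightarrow> p * exp (d * t) \<le> r t"
    using lower_below by metis
  have "((\<lambda>t. ln p / t + d) \<longlongrightarrow> d) at_top" by real_asymp
  then have "\<forall>\<^sub>F t in at_top. c < ln p / t + d" using d(2) by (rule order_tendstoD)
  with eventually_gt_at_top[of 0] show "\<forall>\<^sub>F t in at_top. c < ln (r t) / t"
  proof eventually_elim
    case (elim t)
    have "ln (p * exp (d * t)) \<le> ln (r t)" using elim p r_pos[of t] by (subst ln_le_cancel_iff) auto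
    then have "ln p + d * t \<le> ln (r t)" using p(1) by (simp add: ln_mult)
    then have "(ln p + d * t) / t \<le> ln (r t) / t" using elim(1) by (intro divide_right_mono) auto
    then have "ln p / t + d \<le> ln (r t) / t" using elim(1) by (simp add: add_divide_distrib)
    with elim(2) show ?case by simp
  qed
next
  fix c assume c: "b < c"
  show "\<forall>\<^sub>F t in at_top. ln (r t) / t < c"
    using eventually_gt_at_top[of 0]
  proof eventually_elim
    case (elim t)
    have "ln (r t) \<le> ln (exp (b * t))" using upper[of t] r_pos[of t] elim by (subst ln_le_cancel_iff) auto
    also have "\<dots> < c * t" using c elim by simp
    finally show ?case using elim by (simp add: field_simps)
  qed
qed

definition passage :: "real \<Rightarrow> real" where
  "passage \<theta> = Inf {t. 0 < t \<and> \<theta> < r t}"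

lemma ln_div_rate_le_time:
  assumes "1 \<le> \<theta>" "0 < t" "\<theta> < r t"
  shows "ln \<theta> / b \<le> t"
proof -
  have "\<theta> \<le> exp (b * t)" using upper[of t] assms by linarith
  then have "ln \<theta> \<le> ln (exp (b * t))" using assms by (subst ln_le_cancel_iff) auto
  then show ?thesis using rate_pos by (simp add: field_simps)
qed

lemma exceeds_after:
  assumes "1 \<le> \<theta>" "0 < d" "0 < p" "p \<le> 1" and p: "\<And>t. 0 \<le> t \<Longrightarrow> p * exp (d * t) \<le> r t"
    and t: "(ln \<theta> - ln p) / d < t"
  shows "0 < t \<and> \<theta> < r t"
proof -
  have "0 \<le> (ln \<theta> - ln p) / d" using assms by (auto intro!: divide_nonneg_pos order_trans[of "ln p" 0])
  then have t0: "0 < t" using t by linarith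
  have "ln \<theta> < ln p + d * t" using t assms by (simp add: field_simps)
  also have "\<dots> = ln (p * exp (d * t))" using assms by (simp add: ln_mult)
  finally have "\<theta> < p * exp (d * t)" using assms by simp
  with p[of t] t0 show ?thesis by linarith
qed

lemma passage_bdd: "1 \<le> \<theta> \<Longrightarrow> bdd_below {t. 0 < t \<and> \<theta> < r t}"
  by (auto intro: bdd_belowI[of _ 0])

lemma passage_nonempty: "1 \<le> \<theta> \<Longrightarrow> {t. 0 < t \<and> \<theta> < r t} \<noteq> {}"
proof -
  assume th: "1 \<le> \<theta>"
  obtain d p where "0 < d" "0 < p" "p \<le> 1" "\<And>t. 0 \<le> t \<Longrightarrow> p * exp (d * t) \<le> r t"
    using lower_below[of 0] rate_pos by metis
  from exceeds_after[OF th this, of "(ln \<theta> - ln p) / d + 1"] show ?thesis by auto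
qed

lemma passage_ge: "1 \<le> \<theta> \<Longrightarrow> ln \<theta> / b \<le> passage \<theta>"
  unfolding passage_def by (rule cInf_greatest[OF passage_nonempty]) (auto intro: ln_div_rate_le_time)

lemma passage_div_ln_tendsto: "((\<lambda>\<theta>. passage \<theta> / ln \<theta>) \<longlongrightarrow> 1 / b) at_top"
proof (rule order_tendstoI)
  fix c assume c: "c < 1 / b"
  show "\<forall>\<^sub>F \<theta> in at_top. c < passage \<theta> / ln \<theta>"
    using eventually_gt_at_top[of 1]
  proof eventually_elim
    case (elim \<theta>)
    have "c * ln \<theta> < 1 / b * ln \<theta>" using c elim by (intro mult_strict_right_mono) auto
    also have "\<dots> \<le> passage \<theta>" using passage_ge[of \<theta>] elim by simp
    finally show ?case using elim by (simp add: field_simps)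
  qed
next
  fix c assume c: "1 / b < c"
  then have "0 < c" using rate_pos by (metis less_trans zero_less_divide_1_iff)
  with c have "1 / c < b" using rate_pos by (simp add: field_simps)
  then obtain d p where d: "0 < d" "1 / c < d" and p: "0 < p" "p \<le> 1" "\<And>t. 0 \<le> t \<Longrightarrow> p * exp (d * t) \<le> r t"
    using lower_below by metis
  have "((\<lambda>\<theta>. (ln \<theta> - ln p) / d / ln \<theta>) \<longlongrightarrow> inverse d) at_top" using d(1) by real_asymp
  moreover have "inverse d < c" using d \<open>0 < c\<close> by (simp add: field_simps)
  ultimately have "\<forall>\<^sub>F \<theta> in at_top. (ln \<theta> - ln p) / d / ln \<theta> < c" by (rule order_tendstoD)
  with eventually_gt_at_top[of 1] show "\<forall>\<^sub>F \<theta> in at_top. passage \<theta> / ln \<theta> < c"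
  proof eventually_elim
    case (elim \<theta>)
    have "passage \<theta> \<le> (ln \<theta> - ln p) / d"
    proof (rule dense_ge)
      fix t assume "(ln \<theta> - ln p) / d < t"
      from exceeds_after[OF _ d(1) p this] elim show "passage \<theta> \<le> t"
        unfolding passage_def by (intro cInf_lower passage_bdd) auto
    qed
    then have "passage \<theta> / ln \<theta> \<le> (ln \<theta> - ln p) / d / ln \<theta>"
      using elim by (intro divide_right_mono) auto
    with elim show ?case by simp
  qed
qed

lemma passage_ratio_tendsto:
  assumes l: "1 < l"
  shows "((\<lambda>\<theta>. passage (l * \<theta>) / passage \<theta>) \<longlongrightarrow> 1) at_top"
proof -
  have "filterlim (\<lambda>\<theta>. l * \<theta>) at_top at_top"
    using l by (intro filterlim_tendsto_pos_mult_at_top[OF tendsto_const _ filterlim_ident]) auto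
  from filterlim_compose[OF passage_div_ln_tendsto this]
  have 1: "((\<lambda>\<theta>. passage (l * \<theta>) / ln (l * \<theta>)) \<longlongrightarrow> 1 / b) at_top" .
  have 2: "((\<lambda>\<theta>. ln (l * \<theta>) / ln \<theta>) \<longlongrightarrow> 1) at_top" using l by real_asymp
  show ?thesis
  proof (rule Lim_transform_eventually)
    have "((\<lambda>\<theta>. (passage (l * \<theta>) / ln (l * \<theta>)) * (ln (l * \<theta>) / ln \<theta>) / (passage \<theta> / ln \<theta>)) \<longlongrightarrow> 1 / b * 1 / (1 / b)) at_top"
      using rate_pos by (intro tendsto_divide tendsto_mult 1 2 passage_div_ln_tendsto) auto
    then show "((\<lambda>\<theta>. (passage (l * \<theta>) / ln (l * \<theta>)) * (ln (l * \<theta>) / ln \<theta>) / (passage \<theta> / ln \<theta>)) \<longlongrightarrow> 1) at_top"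
      using rate_pos by simp
    show "\<forall>\<^sub>F \<theta> in at_top. (passage (l * \<theta>) / ln (l * \<theta>)) * (ln (l * \<theta>) / ln \<theta>) / (passage \<theta> / ln \<theta>) = passage (l * \<theta>) / passage \<theta>"
      using eventually_gt_at_top[of 1]
    proof eventually_elim
      case (elim \<theta>)
      have "1 < l * \<theta>" using elim l by (simp add: less_1_mult)
      then show ?case using elim by simp
    qed
  qed
qed

lemma first_passage_eq:
  assumes f: "\<And>t. 0 < t \<Longrightarrow> f t = ennreal (r t)" and th: "1 \<le> \<theta>"
  shows "first_passage f \<theta> = ereal (passage \<theta>)"
proof -
  have "{t. 0 < t \<and> f t > ennreal \<theta>} = {t. 0 < t \<and> \<theta> < r t}"
    using f th by (auto simp: ennreal_less_iff)
  then show ?thesis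
    unfolding first_passage_def passage_def
    using ereal_Inf'[OF passage_bdd[OF th] passage_nonempty[OF th]] by simp
qed

end

section \<open>Feasible pairs\<close>

locale bernstein_exponential_rate = exponential_rate r b for r :: "real \<Rightarrow> real" and b +
  fixes M :: "'w measure" and X :: "'w \<Rightarrow> real" and V :: real
  assumes V_pos: "0 < V"
    and cgf: "\<And>t. 0 \<le> t \<Longrightarrow> cgf M X t = ereal (V * t\<^sup>2 / 2 * r t)"
begin

text \<open>On \<open>t < 1/c\<close> one has \<open>b t < ln (v / V)\<close>, so \<open>V r(t) \<le> v\<close>, and the denominator \<open>1 - c t \<le> 1\<close> only helps.\<close>

lemma feasible_rate:
  assumes v: "V < v"
  shows "feasible M X v (b / ln (v / V))"
  unfolding feasible_def
proof (intro conjI allI impI)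
  define L where "L = ln (v / V)"
  have L: "0 < L" using v V_pos by (simp add: L_def)
  show "0 < v" "0 \<le> b / ln (v / V)" using v V_pos rate_pos L by (auto simp: L_def)
  fix t assume t: "0 \<le> t" "b / ln (v / V) = 0 \<or> t < 1 / (b / ln (v / V))"
  have tL: "b * t < L" using t rate_pos L unfolding L_def[symmetric] by (auto simp: field_simps)
  define q where "q = 1 - b / L * t"
  have q: "0 < q" "q \<le> 1" using tL L rate_pos t by (auto simp: q_def field_simps)
  have "r t \<le> exp (b * t)" using t by (intro upper)
  also have "\<dots> \<le> exp L" using tL by simp
  also have "exp L = v / V" using v V_pos by (simp add: L_def)
  finally have "V * r t \<le> v" using V_pos by (simp add: field_simps)
  then have "V * r t * t\<^sup>2 / 2 \<le> v * t\<^sup>2 / 2" by (simp add: mult_right_mono)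
  also have "\<dots> \<le> v * t\<^sup>2 / (2 * q)"
    using q v V_pos by (intro divide_left_mono) auto
  finally show "cgf M X t \<le> ereal (v * t\<^sup>2 / (2 * (1 - b / ln (v / V) * t)))"
    using t by (simp add: cgf q_def L_def mult_ac)
qed

text \<open>Write \<open>L = ln (v / V)\<close>. If \<open>c < (1 - e) b / L\<close>, feasibility is violated at \<open>t = L / (b (1 - e/2))\<close>: this time
  keeps \<open>1 - c t \<ge> e/2\<close>, while the lower bound with rate \<open>d = b (1 - e/4)\<close> gives
  \<open>r(t) \<ge> p exp (L (1 + e/4))\<close>. Feasibility would then force \<open>p (e/2) exp (L e/4) \<le> 1\<close>, which fails for large \<open>v\<close>,
  uniformly in \<open>c\<close>.\<close>

lemma feasible_lower_bound:
  assumes e: "0 < e" "e < 1"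
  shows "\<forall>\<^sub>F v in at_top. \<forall>c. feasible M X v c \<longrightarrow> (1 - e) * (b / ln (v / V)) \<le> c"
proof -
  define d where "d = b * (1 - e / 4)"
  have d: "0 < d" "d < b" using e rate_pos by (auto simp: d_def)
  then obtain p where p: "p > 0" "\<And>t. 0 \<le> t \<Longrightarrow> p * exp (d * t) \<le> r t"
    using lower by blast
  have "filterlim (\<lambda>v. ln (v / V)) at_top at_top" using V_pos by real_asymp
  then have "\<forall>\<^sub>F v in at_top. max 0 (4 / e * ln (2 / (p * e))) < ln (v / V)"
    unfolding filterlim_at_top_dense by (rule spec)
  with eventually_gt_at_top[of 0] show ?thesis
  proof eventually_elim
    case (elim v)
    define L where "L = ln (v / V)"
    have L: "0 < L" "4 / e * ln (2 / (p * e)) < L" using elim by (auto simp: L_def)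
    have expL: "exp L = v / V" using elim V_pos by (simp add: L_def)
    show ?case
    proof (intro allI impI, rule ccontr)
      fix c assume feas: "feasible M X v c" and "\<not> (1 - e) * (b / ln (v / V)) \<le> c"
      then have c: "0 \<le> c" "c < (1 - e) * (b / L)" by (auto simp: feasible_def L_def)
      define t where "t = L / (b * (1 - e / 2))"
      have t: "0 < t" using L e rate_pos by (simp add: t_def)
      have "c * t \<le> (1 - e) * (b / L) * t" using c t by (intro mult_right_mono) auto
      also have "\<dots> = (1 - e) / (1 - e / 2)" using L e rate_pos by (simp add: t_def field_simps)
      also have "\<dots> \<le> 1 - e / 2" using e by (simp add: field_simps power2_eq_square)
      finally have ct: "e / 2 \<le> 1 - c * t" by simp
      then have "c * t < 1" using e by simp
      then have "c = 0 \<or> t < 1 / c" using c(1) by (cases "c = 0") (auto simp: pos_less_divide_eq mult.commute)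
      then have le: "V * t\<^sup>2 / 2 * r t \<le> v * t\<^sup>2 / (2 * (1 - c * t))"
        using feas t unfolding feasible_def by (auto simp: cgf)
      have "V * (r t * q) \<le> v" if "V * t\<^sup>2 / 2 * r t \<le> v * t\<^sup>2 / (2 * q)" "0 < q" for q
        using that t by (simp add: field_simps)
      from this[OF le] have "V * (r t * (1 - c * t)) \<le> v" using ct e by linarith
      then have rt: "r t * (1 - c * t) \<le> exp L" using V_pos by (simp add: expL field_simps)
      have "L * (1 + e / 4) \<le> d * t"
      proof -
        have "(1 + e / 4) * (1 - e / 2) \<le> 1 - e / 4" using e by (simp add: field_simps)
        then have "1 + e / 4 \<le> (1 - e / 4) / (1 - e / 2)" using e by (simp add: pos_le_divide_eq)
        then have "L * (1 + e / 4) \<le> L * ((1 - e / 4) / (1 - e / 2))" using L by (intro mult_left_mono) auto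
        also have "\<dots> = d * t" using rate_pos by (simp add: d_def t_def)
        finally show ?thesis .
      qed
      then have "p * exp (L * (1 + e / 4)) \<le> p * exp (d * t)" using p(1) by simp
      also have "\<dots> \<le> r t" using p(2) t by simp
      finally have "p * exp (L * (1 + e / 4)) * (e / 2) \<le> r t * (1 - c * t)"
        using ct e r_pos[of t] t by (intro mult_mono) auto
      with rt have "p * exp (L * (1 + e / 4)) * (e / 2) \<le> exp L" by linarith
      then have "exp (L * (e / 4)) * (p * (e / 2)) * exp L \<le> 1 * exp L"
        by (simp add: algebra_simps exp_add)
      then have "exp (L * (e / 4)) * (p * (e / 2)) \<le> 1"
        by (subst (asm) mult_le_cancel_right_pos) auto
      then have "exp (L * (e / 4)) \<le> 2 / (p * e)" using p(1) e by (simp add: field_simps)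
      then have "ln (exp (L * (e / 4))) \<le> ln (2 / (p * e))"
        using p(1) e by (subst ln_le_cancel_iff) auto
      then have "L * (e / 4) \<le> ln (2 / (p * e))" by simp
      with L(2) e show False by (simp add: field_simps)
    qed
  qed
qed

lemma c_star_bounds:
  assumes e: "0 < e" "e < 1"
  shows "\<forall>\<^sub>F v in at_top. ereal ((1 - e) * (b / ln (v / V))) \<le> c_star M X v \<and> c_star M X v \<le> ereal (b / ln (v / V))"
  using feasible_lower_bound[OF e] eventually_gt_at_top[of V]
proof eventually_elim
  case (elim v)
  then show ?case using feasible_rate[of v]
    unfolding c_star_def by (auto intro!: INF_greatest INF_lower)
qed

lemma c_star_finite: "\<forall>\<^sub>F v in at_top. \<bar>c_star M X v\<bar> \<noteq> \<infinity>"
proof -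
  have "\<forall>\<^sub>F v in at_top. ereal ((1 - 1/2) * (b / ln (v / V))) \<le> c_star M X v \<and> c_star M X v \<le> ereal (b / ln (v / V))"
    by (rule c_star_bounds) auto
  then show ?thesis
  proof eventually_elim
    case (elim v)
    then show ?case by (cases "c_star M X v") auto
  qed
qed

lemma c_star_asymp_equiv:
  "(\<lambda>v. real_of_ereal (c_star M X v)) \<sim>[at_top] (\<lambda>v. b / ln (v / V))"
proof (rule asymp_equivI', rule tendstoI)
  fix e :: real assume e: "0 < e"
  define e' where "e' = min (e / 2) (1 / 2)"
  have e': "0 < e'" "e' < 1" "e' < e" using e by (auto simp: e'_def)
  show "\<forall>\<^sub>F v in at_top. dist (real_of_ereal (c_star M X v) / (b / ln (v / V))) 1 < e"
    using c_star_bounds[OF e'(1,2)] eventually_gt_at_top[of V]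
  proof eventually_elim
    case (elim v)
    define L where "L = b / ln (v / V)"
    have L: "0 < L" using elim(2) V_pos rate_pos by (simp add: L_def)
    obtain s where s: "c_star M X v = ereal s" "(1 - e') * L \<le> s" "s \<le> L"
      using elim(1) by (cases "c_star M X v") (auto simp: L_def)
    have "1 - e' \<le> s / L" "s / L \<le> 1" using s L by (auto simp: field_simps)
    then show ?case using e' s(1) by (simp add: L_def[symmetric] dist_real_def)
  qed
qed

end

section \<open>Bernstein constants of infinitely divisible laws\<close>

theorem corollary5p6:
  fixes M :: "'w measure" and X :: "'w \<Rightarrow> real"
    and N :: "'u measure" and B Z R :: "'u \<Rightarrow> real"
    and \<nu> :: "real measure" and a V b :: real
  assumes "prob_space M" and "X \<in> borel_measurable M"
    and "infinitely_divisible (distr M borel X)"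
    and "has_levy_khintchine (distr M borel X) a \<nu>"
    and "integrable M X" and "integrable M (\<lambda>w. (X w)\<^sup>2)"
    and "prob_space.expectation M X = 0"
    and "V = prob_space.variance M X" and "0 < V"
    and "prob_space N"
    and "Z \<in> borel_measurable N"
    and "distr N borel Z = scale_measure (ennreal (1 / V)) (H_measure a \<nu>)"
    and "distributed N lborel B (\<lambda>x. ennreal (2 * (1 - x) * indicator {0<..<1} x))"
    and "prob_space.indep_var N borel B borel Z"
    and "R = (\<lambda>w. B w * Z w)"
    and "0 < b"
    and "(SUP x\<in>{x. 0 < x \<and> x \<in> measure_supp \<nu>}. ereal x) = ereal b"
  shows "((\<lambda>t. ext_ln (mgf N R t) / ereal t) \<longlongrightarrow> ereal b) at_top
    \<and> (\<forall>l>1. ((\<lambda>\<theta>. first_passage (mgf N R) (l * \<theta>) / first_passage (mgf N R) \<theta>) \<longlongrightarrow> 1) at_top)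
    \<and> (\<forall>\<^sub>F v in at_top. \<bar>c_star M X v\<bar> \<noteq> \<infinity>)
    \<and> (\<lambda>v. real_of_ereal (c_star M X v)) \<sim>[at_top] (\<lambda>v. b / ln (v / V))"
proof -
  have [measurable]: "X \<in> borel_measurable M" by fact
  interpret M: prob_space M by fact
  interpret N: prob_space N by fact
  have \<nu>: "sets \<nu> = sets borel"
    using assms(4) by (simp add: has_levy_khintchine_def levy_measure_def)
  note supp = AE_le_of_measure_supp[OF \<nu> \<open>0 < b\<close> assms(17)]
  interpret right_bounded_levy_law "distr M borel X" \<nu> "distr N borel Z" a V b
  proof (intro right_bounded_levy_law.intro centered_levy_law.intro right_bounded_levy_law_axioms.intro)
    show "real_distribution (distr M borel X)" by (rule M.real_distribution_distr) fact
    show "real_distribution (distr N borel Z)" by (rule N.real_distribution_distr) fact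
    show "integrable (distr M borel X) (\<lambda>x. x\<^sup>2)" using assms(6) by (simp add: integrable_distr_eq)
    show "(\<integral>x. x \<partial>distr M borel X) = 0" using assms(7) by (simp add: integral_distr)
    show "(\<integral>x. x\<^sup>2 \<partial>distr M borel X) = V" using assms(7,8) by (simp add: integral_distr)
  qed (use assms supp in auto)
  define r where "r = (\<lambda>t. enn2real (mgf N R t))"
  have mgf_R: "mgf N R t = (\<integral>\<^sup>+z. ennreal (expm2_quot (t * z)) \<partial>distr N borel Z)" for t
    unfolding assms(15) by (rule mgf_beta12_multiple) fact+
  have mgf_r: "mgf N R t = ennreal (r t)" if "0 \<le> t" for t
    unfolding r_def using mgf_zeta_le[OF that] by (subst ennreal_enn2real) (auto simp: mgf_R less_top[symmetric] top_unique)
  have cgf: "cgf M X t = ereal (V * t\<^sup>2 / 2 * r t)" if t: "0 \<le> t" for t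
  proof -
    have k: "cumulant t = V * t\<^sup>2 / 2 * r t"
    proof (cases "t = 0")
      case True then show ?thesis by (simp add: cumulant_def)
    next
      case False
      with t have "0 < t" by simp
      have r0: "0 \<le> r t" by (simp add: r_def)
      have "ennreal (cumulant t) = ennreal (V * t\<^sup>2 / 2 * r t)"
        using cumulant_eq_mgf[OF \<open>0 < t\<close>] mgf_r[OF t]
        by (simp add: mgf_R ennreal_mult''[OF r0] del: times_divide_eq_left)
      moreover have "0 \<le> cumulant t"
        unfolding cumulant_def using a_nonneg exp_ge_add_one_self
        by (auto simp: diff_diff_eq intro!: add_nonneg_nonneg Bochner_Integration.integral_nonneg)
      ultimately show ?thesis using V_pos r0 by (subst (asm) ennreal_inj) auto
    qed
    have int: "integrable (distr M borel X) (\<lambda>x. exp (x * t))"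
      using integrable_exp[of t] t by (cases "t = 0") (auto simp: mult.commute)
    have "mgf M X t = (\<integral>\<^sup>+x. ennreal (exp (x * t)) \<partial>distr M borel X)"
      unfolding mgf_def by (simp add: nn_integral_distr mult.commute)
    also have "\<dots> = ennreal (exp (cumulant t))"
      using int by (subst nn_integral_eq_integral) (auto simp: exp_moment_eq_exp_cumulant[OF t])
    finally show ?thesis by (simp add: cgf_def ext_ln_def k)
  qed
  interpret bernstein_exponential_rate r b M X V
  proof
    fix t :: real assume t: "0 \<le> t"
    show "r t \<le> exp (b * t)" using mgf_zeta_le[OF t] mgf_r[OF t] by (simp add: mgf_R)
  next
    fix c assume "0 < c" "c < b"
    from mgf_zeta_ge[OF this supp(2)] obtain p where p: "p > 0" "\<And>t. 0 \<le> t \<Longrightarrow> ennreal (p * exp (c * t)) \<le> ennreal (r t)"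
      using mgf_r unfolding mgf_R by auto
    show "\<exists>p>0. \<forall>t\<ge>0. p * exp (c * t) \<le> r t"
      using p by (intro exI[of _ p]) (auto simp: r_def)
  qed (use assms cgf in auto)
  have "((\<lambda>t. ext_ln (mgf N R t) / ereal t) \<longlongrightarrow> ereal b) at_top"
  proof (rule Lim_transform_eventually)
    show "((\<lambda>t. ereal (ln (r t) / t)) \<longlongrightarrow> ereal b) at_top"
      using ln_div_tendsto by simp
    show "\<forall>\<^sub>F t in at_top. ereal (ln (r t) / t) = ext_ln (mgf N R t) / ereal t"
      using eventually_gt_at_top[of 0]
    proof eventually_elim
      case (elim t)
      then show ?case using r_pos[of t] by (simp add: mgf_r ext_ln_def)
    qed
  qed
  moreover have "((\<lambda>\<theta>. first_passage (mgf N R) (l * \<theta>) / first_passage (mgf N R) \<theta>) \<longlongrightarrow> 1) at_top" if l: "1 < l" for l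
  proof (rule Lim_transform_eventually)
    show "((\<lambda>\<theta>. ereal (passage (l * \<theta>) / passage \<theta>)) \<longlongrightarrow> 1) at_top"
      using passage_ratio_tendsto[OF l] by (simp add: one_ereal_def)
    show "\<forall>\<^sub>F \<theta> in at_top. ereal (passage (l * \<theta>) / passage \<theta>) = first_passage (mgf N R) (l * \<theta>) / first_passage (mgf N R) \<theta>"
      using eventually_gt_at_top[of 1]
    proof eventually_elim
      case (elim \<theta>)
      have "1 < l * \<theta>" using elim l by (simp add: less_1_mult)
      moreover have "0 < passage \<theta>" using passage_ge[of \<theta>] elim rate_pos by (smt (verit) divide_pos_pos ln_gt_zero)
      ultimately show ?case using elim by (simp add: first_passage_eq mgf_r)
    qed
  qed
  ultimately show ?thesis using c_star_finite c_star_asymp_equiv by blast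
qed

end
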